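(* Let $\{\hat f(n)\}_{n\in\mathbb{Z}}$ be complex numbers such that $\{\hat f(n)\}_{n=0}^{\infty}\in\mathrm{GBV}$ and $\{\hat f(n)+\hat f(-n)\}_{n=1}^{\infty}\in\mathrm{GBV}$, and let $$f(x)=\sum_{n=-\infty}^{\infty}\hat f(n)e^{inx}.$$ Then $f\in C_{2\pi}$ if and only if $$\sum_{n=1}^{\infty}|\hat f(n)+\hat f(-n)|<\infty\quad\text{and}\quad \lim_{n\to\infty}n\hat f(n)=0.$$ Furthermore, if $f\in C_{2\pi}$, then $$E_n(f)\approx \max_{1\le k\le n}k\left(|\hat f(n+k)|+|\hat f(-n-k)|\right)+\max_{k\ge 2n+1}k\left|\hat f(k)-\hat f(-k)\right|+\sum_{k=2n+1}^{\infty}|\hat f(k)+\hat f(-k)|,\qquad n=1,2,\dots$$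
   Context: $C_{2\pi}$ is the space of all real or complex valued continuous $2\pi$-periodic functions on $\mathbb{R}$ with norm $\|f\|=\max_{x}|f(x)|$. $E_n(f)$ is the best approximation of $f$ in this norm by (complex) trigonometric polynomials of degree at most $n$, i.e. the infimum of $\|f-t\|$ over such $t$. A series $\sum_{k=-\infty}^{\infty}c_ke^{ikx}$ is understood as $\lim_{n\to\infty}\sum_{k=-n}^{n}c_ke^{ikx}$, and $f(x)$ denotes its sum at any point $x$ where it converges. The statement $f\in C_{2\pi}$ means that the series converges at every $x$ and its sum $f$ belongs to $C_{2\pi}$. For $\theta\in[0,\pi/2)$, $K(\theta)=\{z\in\mathbb{C}:|\arg z|\le\theta\}$, with $0\in K(\theta)$ by convention. $\Delta c_n=c_n-c_{n+1}$. Class GBV: a complex sequence $\mathbf c=\{c_n\}$ belongs to GBV if there is $\theta_1\in[0,\pi/2)$ with $c_n\in K(\theta_1)$ for all $n=1,2,\dots$, and there are a natural number $N_0\geq 1$ and a positive constant $M(\mathbf c)$ depending only on $\mathbf c$ such that $$\sum_{n=m}^{2m}|\Delta c_n|\le M(\mathbf c)\max_{m\le n<m+N_0}|c_n|\quad\text{for all } m=1,2,\dots.$$ For a sequence indexed from $n=0$, these conditions are imposed only for indices $n,m\ge1$ as written. $A_n\approx B_n$ means there is a constant $C>0$ independent of $n$ with $C^{-1}B_n\le A_n\le CB_n$. *)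

theory Defs
  imports "HOL-Analysis.Analysis"
begin

definition C2pi :: "(real \<Rightarrow> complex) set" where
  "C2pi = {f. continuous_on UNIV f \<and> (\<forall>x. f (x + 2 * pi) = f x)}"

text \<open>
  On continuous periodic functions the supremum is attained, so this is the maximum norm.
\<close>
definition sup_norm :: "(real \<Rightarrow> complex) \<Rightarrow> real" where
  "sup_norm f = (SUP x. norm (f x))"

definition trig_sum :: "(int \<Rightarrow> complex) \<Rightarrow> nat \<Rightarrow> real \<Rightarrow> complex" where
  "trig_sum c n x = (\<Sum>k = - int n..int n. c k * exp (\<i> * of_int k * of_real x))"

definition trig_polys :: "nat \<Rightarrow> (real \<Rightarrow> complex) set" where
  "trig_polys n = range (\<lambda>c. trig_sum c n)"

definition best_approx :: "nat \<Rightarrow> (real \<Rightarrow> complex) \<Rightarrow> real" where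
  "best_approx n f = (INF t\<in>trig_polys n. sup_norm (\<lambda>x. f x - t x))"

text \<open>
  Two-sided series are summed by symmetric partial sums. The value of \<open>trig_series\<close>
  is meaningful only at points of convergence, so \<open>series_in_C2pi\<close> requires
  convergence at every point in addition to membership of the sum in \<open>C2pi\<close>.
\<close>
definition trig_series :: "(int \<Rightarrow> complex) \<Rightarrow> real \<Rightarrow> complex" where
  "trig_series c x = lim (\<lambda>n. trig_sum c n x)"

definition series_in_C2pi :: "(int \<Rightarrow> complex) \<Rightarrow> bool" where
  "series_in_C2pi c \<longleftrightarrow>
     (\<forall>x. convergent (\<lambda>n. trig_sum c n x)) \<and> trig_series c \<in> C2pi"

definition cone :: "real \<Rightarrow> complex set" where
  "cone \<theta> = {z. z = 0 \<or> \<bar>Arg z\<bar> \<le> \<theta>}"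

text \<open>The value \<open>c 0\<close> plays no role here: all conditions concern indices from 1 on.\<close>
definition GBV :: "(nat \<Rightarrow> complex) \<Rightarrow> bool" where
  "GBV c \<longleftrightarrow>
     (\<exists>\<theta>\<in>{0..<pi/2}. \<forall>n\<ge>1. c n \<in> cone \<theta>) \<and>
     (\<exists>N\<ge>1. \<exists>M>0. \<forall>m\<ge>1.
        (\<Sum>n = m..2 * m. norm (c n - c (Suc n))) \<le> M * Max ((\<lambda>n. norm (c n)) ` {m..<m + N}))"

definition same_order :: "(nat \<Rightarrow> real) \<Rightarrow> (nat \<Rightarrow> real) \<Rightarrow> bool" where
  "same_order A B \<longleftrightarrow> (\<exists>C>0. \<forall>n\<ge>1. inverse C * B n \<le> A n \<and> A n \<le> C * B n)"

end

theory Submission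
  imports Defs
begin

text \<open>
  Write \<open>a\<^sub>k\<close> for the \<open>k\<close>-th coefficient and \<open>b\<^sub>k\<close> for the sum of the \<open>k\<close>-th and the
  \<open>(-k)\<close>-th one, so that the \<open>k\<close>-th term of the series is \<open>b\<^sub>k cis (-kx) + 2i a\<^sub>k sin kx\<close>.
  At \<open>x = 0\<close> the cone condition turns convergence into absolute convergence of \<open>b\<close>. By the theorem of
  du Bois-Reymond, the coefficients of a series converging everywhere to a continuous function are
  its Fourier coefficients, so Fejer means of blocks of coefficients are bounded by the norm
  of the function; with the cone condition and the bounded block variation they dominate \<open>k\<close> times
  the central coefficient. This yields \<open>k a\<^sub>k \<longrightarrow> 0\<close> and, applied to \<open>f\<close> minus a polynomial, the lower
  bounds for the best approximation; the tail of \<open>b\<close> is read off de la Vallee-Poussin means at \<open>0\<close>.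
  Conversely, a sine sum with \<open>k |a\<^sub>k| \<le> \<epsilon>\<close> and bounded block variation is \<open>O(\<epsilon>)\<close>, by splitting at
  \<open>k = 1 / |1 - cis x|\<close> and summing the rest by parts. This gives uniform convergence and
  the upper bound.
\<close>


subsection \<open>Coefficients of convergent trigonometric series\<close>

text \<open>A Fejer mean over a block of radius \<open>N\<close> has central weight 1 and total
  weight \<open>N\<close>, so a bound on the function controls a whole block at once. The cone
  condition excludes cancellation inside the block and bounded block variation compares the centre
  with its neighbours; together they produce the factor \<open>k\<close>. The block of radius
  \<open>k\<close> around \<open>n + k\<close> lies above \<open>n\<close>, so its mean does not
  change when a polynomial of degree \<open>n\<close> is subtracted. This is why frequency
  \<open>n + k\<close> is weighted by \<open>k\<close>, its distance from \<open>n\<close>. Negative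
  frequencies have no cone or variation condition of their own: a coefficient at \<open>-k\<close>
  is always reached as the symmetric sum minus the coefficient at \<open>k\<close>.\<close>

definition trig_term :: "(int \<Rightarrow> complex) \<Rightarrow> nat \<Rightarrow> real \<Rightarrow> complex" where
  "trig_term c k x = c (int k) * cis (real k * x) + c (- int k) * cis (- (real k * x))"

lemma trig_sum_cis: "trig_sum c n x = (\<Sum>k = - int n..int n. c k * cis (of_int k * x))"
  by (simp add: trig_sum_def cis_conv_exp mult_ac)

lemma sum_symmetric_int:
  fixes g :: "int \<Rightarrow> 'a::ab_group_add"
  shows "(\<Sum>k = - int n..int n. g k) = g 0 + (\<Sum>k = 1..n. g (int k) + g (- int k))"
proof (induction n)
  case (Suc n)
  have "{- int (Suc n)..int (Suc n)} = insert (int (Suc n)) (insert (- int (Suc n)) {- int n..int n})"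
    by auto
  then show ?case
    using Suc by (simp add: algebra_simps)
qed simp

lemma trig_sum_conv_terms: "trig_sum c n x = c 0 + (\<Sum>k = 1..n. trig_term c k x)"
  by (simp add: trig_sum_cis sum_symmetric_int trig_term_def)

lemma trig_sum_Suc: "trig_sum c (Suc n) x = trig_sum c n x + trig_term c (Suc n) x"
  by (simp add: trig_sum_conv_terms add.assoc)

lemma cis_periodic: "cis (of_int k * (x + 2 * pi)) = cis (of_int k * x)"
proof -
  have "cis (of_int k * (x + 2 * pi)) = cis (of_int k * x) * cis (2 * pi * of_int k)"
    by (simp add: cis_mult algebra_simps)
  then show ?thesis by simp
qed

lemma has_integral_cis:
  fixes k :: int
  shows "((\<lambda>x. cis (of_int k * x)) has_integral (if k = 0 then 2 * pi else 0)) {-pi..pi}"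
proof (cases "k = 0")
  case True
  show ?thesis
    using has_integral_const_real[of "1::complex" "-pi" pi] True
    by (simp add: scaleR_conv_of_real)
next
  case False
  let ?G = "\<lambda>x. cis (of_int k * x) / (\<i> * of_int k)"
  have "((\<lambda>x. cis (of_int k * x)) has_integral (?G pi - ?G (-pi))) {-pi..pi}"
  proof (rule fundamental_theorem_of_calculus)
    fix x :: real
    show "(?G has_vector_derivative cis (of_int k * x)) (at x within {-pi..pi})"
      unfolding has_vector_derivative_def using False
      by (auto intro!: derivative_eq_intros simp: field_simps scaleR_conv_of_real fun_eq_iff)
  qed simp
  moreover have "?G pi = ?G (-pi)"
    using cis_periodic[of k "-pi"] by simp
  ultimately show ?thesis using False by simp
qed

text \<open>Multiplying the \<open>k\<close>-th term by \<open>cis (-kx)\<close> leaves \<open>c k\<close> plus an oscillation of mean zero,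
  so dominated convergence recovers \<open>c k\<close>; dividing by the size of the coefficients
  supplies the dominating function.\<close>
lemma trig_terms_null_imp_bounded:
  assumes lim: "\<And>x. (\<lambda>k. trig_term c k x) \<longlonglongrightarrow> 0"
  shows "\<exists>B. \<forall>k. norm (c k) \<le> B"
proof -
  define L where "L k = max 1 (norm (c (int k)) + norm (c (- int k)))" for k
  have L1: "L k \<ge> 1" and L2: "norm (c (int k)) + norm (c (- int k)) \<le> L k" for k
    by (auto simp: L_def)
  \<comment> \<open>One argument covers both signs: the factor of frequency \<open>- s k\<close>
    turns the coefficient at \<open>s k\<close>, scaled by \<open>L k\<close>, into the mean value
    of \<open>h k\<close>.\<close>
  have lim0: "(\<lambda>k. c (s * int k) / of_real (L k)) \<longlonglongrightarrow> 0" if s: "s = 1 \<or> s = -1" for s :: int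
  proof -
    define h where "h k x = cis (- (of_int s * (real k * x))) * trig_term c k x / of_real (L k)" for k x
    have h: "h k x = c (s * int k) / of_real (L k) +
        c (- (s * int k)) / of_real (L k) * cis (of_int (- 2 * s * int k) * x)" for k x
      using s by (auto simp: h_def trig_term_def cis_mult algebra_simps add_divide_distrib)
    have int_h: "(h k has_integral 2 * pi * (c (s * int k) / of_real (L k))) {-pi..pi}"
      if "k > 0" for k
    proof -
      have "((\<lambda>x. c (s * int k) / of_real (L k) +
        c (- (s * int k)) / of_real (L k) * cis (of_int (- 2 * s * int k) * x)) has_integral
        (2 * pi * (c (s * int k) / of_real (L k)) +
         c (- (s * int k)) / of_real (L k) * (if - 2 * s * int k = 0 then 2 * pi else 0))) {-pi..pi}"
        by (intro has_integral_add has_integral_mult_right has_integral_cis)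
           (use has_integral_const_real[of "c (s * int k) / of_real (L k)" "-pi" pi] in
             \<open>simp add: scaleR_conv_of_real\<close>)
      then show ?thesis using that s by (auto simp: h[abs_def])
    qed
    have nh: "norm (h k x) \<le> 1" for k x
    proof -
      have "norm (trig_term c k x) \<le> L k"
        unfolding trig_term_def using L2[of k]
        by (intro order_trans[OF norm_triangle_ineq]) (simp add: norm_mult)
      then show ?thesis using L1[of k] by (simp add: h_def norm_mult norm_divide)
    qed
    have "(\<lambda>k. integral {-pi..pi} (h (Suc k))) \<longlonglongrightarrow> integral {-pi..pi} (\<lambda>x. 0)"
    proof (rule dominated_convergence)
      show "h (Suc k) integrable_on {-pi..pi}" for k
        using int_h[of "Suc k"] by (auto simp: integrable_on_def)
      show "(\<lambda>x. 1::real) integrable_on {-pi..pi}" by (rule integrable_const_ivl)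
      show "norm (h (Suc k) x) \<le> 1" for k x by (rule nh)
      show "(\<lambda>k. h (Suc k) x) \<longlonglongrightarrow> 0" for x
      proof (rule Lim_null_comparison)
        show "\<forall>\<^sub>F k in sequentially. norm (h (Suc k) x) \<le> norm (trig_term c (Suc k) x)"
        proof (rule always_eventually, rule allI)
          fix k
          show "norm (h (Suc k) x) \<le> norm (trig_term c (Suc k) x)"
            using L1[of "Suc k"] mult_left_mono[of 1 "L (Suc k)" "norm (trig_term c (Suc k) x)"]
            by (simp add: h_def norm_mult norm_divide divide_le_eq)
        qed
        show "(\<lambda>k. norm (trig_term c (Suc k) x)) \<longlonglongrightarrow> 0"
          using LIMSEQ_Suc[OF lim[of x]] by (rule tendsto_norm_zero)
      qed
    qed
    then have "(\<lambda>k. 2 * pi * (c (s * int (Suc k)) / of_real (L (Suc k)))) \<longlonglongrightarrow> 0"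
      using integral_unique[OF int_h] by (simp only: zero_less_Suc integral_0)
    then have "(\<lambda>k. inverse (2 * of_real pi) * (2 * pi * (c (s * int (Suc k)) / of_real (L (Suc k)))))
       \<longlonglongrightarrow> inverse (2 * of_real pi) * 0"
      by (rule tendsto_mult_left)
    then have "(\<lambda>k. c (s * int (Suc k)) / of_real (L (Suc k))) \<longlonglongrightarrow> 0"
      by (simp add: field_simps)
    then show ?thesis by (rule LIMSEQ_imp_Suc)
  qed
  have "(\<lambda>k. norm (c (1 * int k) / of_real (L k)) + norm (c (- 1 * int k) / of_real (L k))) \<longlonglongrightarrow> 0"
    using tendsto_add[OF tendsto_norm_zero[OF lim0[of 1]] tendsto_norm_zero[OF lim0[of "-1"]]] by simp
  then have "\<forall>\<^sub>F k in sequentially.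
      norm (c (1 * int k) / of_real (L k)) + norm (c (- 1 * int k) / of_real (L k)) < 1"
    by (rule order_tendstoD) simp
  then obtain K where K: "\<And>k. k \<ge> K \<Longrightarrow>
      norm (c (1 * int k) / of_real (L k)) + norm (c (- 1 * int k) / of_real (L k)) < 1"
    by (auto simp: eventually_sequentially)
  \<comment> \<open>If the two moduli added up to more than 1, \<open>L k\<close> would equal their
    sum and the quotient bounded in \<open>K\<close> would be exactly 1.\<close>
  have small: "norm (c (int k)) + norm (c (- int k)) \<le> 1" if "k \<ge> K" for k
  proof -
    have "norm (c (int k)) + norm (c (- int k)) < L k"
      using K[OF that] L1[of k] by (simp add: norm_divide add_divide_distrib[symmetric])
    then show ?thesis by (auto simp: L_def max_def split: if_splits)
  qed
  define B where "B = max 1 (Max ((\<lambda>k. norm (c k)) ` {- int K..int K}))"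
  have "norm (c k) \<le> B" for k
  proof (cases "k \<in> {- int K..int K}")
    case True
    then show ?thesis by (auto simp: B_def intro!: max.coboundedI2 Max_ge)
  next
    case False
    then have *: "nat \<bar>k\<bar> \<ge> K" by auto
    have "k = int (nat \<bar>k\<bar>) \<or> k = - int (nat \<bar>k\<bar>)" by auto
    with small[OF *] norm_ge_zero[of "c (int (nat \<bar>k\<bar>))"] norm_ge_zero[of "c (- int (nat \<bar>k\<bar>))"]
    have "norm (c k) \<le> 1" by (metis add_increasing2 add_increasing add.commute dual_order.trans le_add_same_cancel2)
    then show ?thesis by (simp add: B_def)
  qed
  then show ?thesis by blast
qed

text \<open>A weak form of the Cantor-Lebesgue theorem; boundedness is all that the integrated
  series, with its factors \<open>1 / k^2\<close>, requires.\<close>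

lemma trig_series_coeffs_bounded:
  assumes "\<And>x. convergent (\<lambda>n. trig_sum c n x)"
  shows "\<exists>B. \<forall>k. norm (c k) \<le> B"
proof (rule trig_terms_null_imp_bounded)
  fix x
  obtain l where l: "(\<lambda>n. trig_sum c n x) \<longlonglongrightarrow> l"
    using assms by (auto simp: convergent_def)
  have "(\<lambda>n. trig_sum c (Suc n) x - trig_sum c n x) \<longlonglongrightarrow> l - l"
    by (intro tendsto_diff LIMSEQ_Suc l)
  then have "(\<lambda>n. trig_term c (Suc n) x) \<longlonglongrightarrow> 0"
    by (simp add: trig_sum_Suc)
  then show "(\<lambda>k. trig_term c k x) \<longlonglongrightarrow> 0"
    by (rule LIMSEQ_imp_Suc)
qed


subsection \<open>Regular summation by squares of the sinc function\<close>

lemma sum_by_parts: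
  fixes c u :: "nat \<Rightarrow> 'a::comm_ring_1"
  assumes "p \<le> n"
  shows "(\<Sum>k=p..n. c k * u k) =
    c n * (\<Sum>k=p..n. u k) + (\<Sum>k=p..<n. (c k - c (Suc k)) * (\<Sum>j=p..k. u j))"
  using assms by (induction n rule: dec_induct) (simp_all add: algebra_simps)

text \<open>A summability theorem of Toeplitz type. Summation by parts expresses the error through
  the remainders \<open>r k\<close> of the partial sums: far out they are small and meet weights of
  bounded total variation, while the finitely many early differences of the weights vanish as
  \<open>N\<close> grows.\<close>

lemma regular_summation:
  fixes A :: "nat \<Rightarrow> complex" and w :: "nat \<Rightarrow> nat \<Rightarrow> real"
  assumes sums: "A sums s"
    and w0: "\<And>N. w N 0 = 1"
    and w1: "\<And>N k. \<bar>w N k\<bar> \<le> 1"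
    and lim: "\<And>k. (\<lambda>N. w N k) \<longlonglongrightarrow> 1"
    and variation: "\<And>N n. (\<Sum>k<n. \<bar>w N k - w N (Suc k)\<bar>) \<le> C"
    and S: "\<And>N. (\<lambda>k. of_real (w N k) * A k) sums S N"
  shows "S \<longlonglongrightarrow> s"
proof -
  define r where "r k = (\<Sum>j<Suc k. A j) - s" for k
  have r0: "r \<longlonglongrightarrow> 0"
  proof -
    have "(\<lambda>k. \<Sum>j<Suc k. A j) \<longlonglongrightarrow> s"
      using LIMSEQ_Suc[OF sums[unfolded sums_def]] .
    from tendsto_diff[OF this tendsto_const[of s]] show ?thesis by (simp add: r_def[abs_def])
  qed
  then obtain R where R: "\<And>k. norm (r k) \<le> R"
    by (meson BseqE convergentI convergent_imp_Bseq)
  have C0: "C \<ge> 0" using variation[of 0 0] by simp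
  have id: "(\<Sum>k<Suc n. of_real (w N k) * A k) - s =
      of_real (w N n) * r n + (\<Sum>k<n. of_real (w N k - w N (Suc k)) * r k)" for N n
  proof -
    have "(\<Sum>k<n. of_real (w N k) - of_real (w N (Suc k)) :: complex) = 1 - of_real (w N n)"
      using w0[of N] by (induction n) auto
    then have tel: "(\<Sum>k<n. (of_real (w N k) - of_real (w N (Suc k))) * s) = (1 - of_real (w N n)) * s"
      by (simp only: sum_distrib_right[symmetric])
    have "(\<Sum>k<n. of_real (w N k - w N (Suc k)) * r k) =
        (\<Sum>k<n. (of_real (w N k) - of_real (w N (Suc k))) * (\<Sum>j<Suc k. A j)) - (1 - of_real (w N n)) * s"
      by (simp only: tel[symmetric] sum_subtractf[symmetric] r_def of_real_diff right_diff_distrib)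
    then show ?thesis
      using sum_by_parts[of 0 n "\<lambda>k. of_real (w N k)" A]
      by (simp only: r_def atLeast0AtMost atLeast0LessThan lessThan_Suc_atMost) (simp add: ring_distribs)
  qed
  show ?thesis
  proof (rule LIMSEQ_I)
    fix e :: real assume "e > 0"
    \<comment> \<open>Beyond \<open>K\<close> the error is at most \<open>d\<close> from the
      boundary term plus \<open>C * d\<close> from the variation; \<open>C + 2\<close> in place of
      \<open>C + 1\<close> makes this strictly less than \<open>e / 2\<close>.\<close>
    define d where "d = e / (2 * (C + 2))"
    have d: "d > 0" "d * (C + 1) < e / 2" using \<open>e > 0\<close> C0 by (auto simp: d_def field_simps add_pos_nonneg)
    from LIMSEQ_D[OF r0 d(1)] obtain K where K: "\<And>k. k \<ge> K \<Longrightarrow> norm (r k) < d" by auto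
    have bound: "norm (S N - s) \<le> R * (\<Sum>k<K. \<bar>w N k - w N (Suc k)\<bar>) + d * (C + 1)" for N
    proof (rule LIMSEQ_le_const2)
      show "(\<lambda>n. norm ((\<Sum>k<Suc n. of_real (w N k) * A k) - s)) \<longlonglongrightarrow> norm (S N - s)"
        by (intro tendsto_norm tendsto_diff tendsto_const LIMSEQ_Suc S[unfolded sums_def])
      show "\<exists>n0. \<forall>n\<ge>n0. norm ((\<Sum>k<Suc n. of_real (w N k) * A k) - s)
           \<le> R * (\<Sum>k<K. \<bar>w N k - w N (Suc k)\<bar>) + d * (C + 1)"
      proof (rule exI[of _ K], intro allI impI)
        fix n assume n: "n \<ge> K"
        have "norm ((\<Sum>k<Suc n. of_real (w N k) * A k) - s) \<le>
            \<bar>w N n\<bar> * norm (r n) + (\<Sum>k<n. \<bar>w N k - w N (Suc k)\<bar> * norm (r k))"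
          unfolding id by (intro order_trans[OF norm_triangle_ineq] add_mono order_trans[OF norm_sum])
            (simp_all add: norm_mult del: of_real_diff)
        also have "(\<Sum>k<n. \<bar>w N k - w N (Suc k)\<bar> * norm (r k)) =
            (\<Sum>k<K. \<bar>w N k - w N (Suc k)\<bar> * norm (r k)) + (\<Sum>k=K..<n. \<bar>w N k - w N (Suc k)\<bar> * norm (r k))"
          using n by (metis (no_types, lifting) atLeast0LessThan sum.atLeastLessThan_concat zero_le)
        also have "(\<Sum>k<K. \<bar>w N k - w N (Suc k)\<bar> * norm (r k)) \<le> (\<Sum>k<K. \<bar>w N k - w N (Suc k)\<bar> * R)"
          by (intro sum_mono mult_left_mono R) auto
        also have "(\<Sum>k=K..<n. \<bar>w N k - w N (Suc k)\<bar> * norm (r k)) \<le> (\<Sum>k=K..<n. \<bar>w N k - w N (Suc k)\<bar> * d)"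
          using K by (intro sum_mono mult_left_mono) (auto intro: less_imp_le)
        also have "\<dots> \<le> (\<Sum>k<n. \<bar>w N k - w N (Suc k)\<bar> * d)"
          using d by (intro sum_mono2) auto
        also have "\<dots> \<le> C * d"
          using variation[of N n] d(1) by (simp add: sum_distrib_right[symmetric])
        also have "\<bar>w N n\<bar> * norm (r n) \<le> 1 * d"
          using w1[of N n] K[OF n] by (intro mult_mono) auto
        finally show "norm ((\<Sum>k<Suc n. of_real (w N k) * A k) - s)
           \<le> R * (\<Sum>k<K. \<bar>w N k - w N (Suc k)\<bar>) + d * (C + 1)"
          by (simp add: sum_distrib_left algebra_simps)
      qed
    qed
    have "(\<lambda>N. R * (\<Sum>k<K. \<bar>w N k - w N (Suc k)\<bar>)) \<longlonglongrightarrow> R * (\<Sum>k<K. \<bar>1 - 1\<bar>)"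
      by (intro tendsto_intros lim)
    then have "(\<lambda>N. R * (\<Sum>k<K. \<bar>w N k - w N (Suc k)\<bar>)) \<longlonglongrightarrow> 0" by simp
    from LIMSEQ_D[OF this, of "e/2"] \<open>e > 0\<close> obtain N0
      where N0: "\<And>N. N \<ge> N0 \<Longrightarrow> \<bar>R * (\<Sum>k<K. \<bar>w N k - w N (Suc k)\<bar>)\<bar> < e / 2" by auto
    show "\<exists>no. \<forall>n\<ge>no. norm (S n - s) < e"
    proof (rule exI[of _ N0], intro allI impI)
      fix N assume "N \<ge> N0"
      from N0[OF this] bound[of N] d(2) show "norm (S N - s) < e" by linarith
    qed
  qed
qed

section \<open>Lipschitz bound for sinc and total variation of its square\<close>

definition sinc :: "real \<Rightarrow> real" where
  "sinc t = (if t = 0 then 1 else sin t / t)"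

lemma abs_sinc_le_1: "\<bar>sinc t\<bar> \<le> 1"
  using abs_sin_x_le_abs_x[of t] by (auto simp: sinc_def divide_le_eq abs_divide)

lemma abs_t_sinc_le_1: "\<bar>t * sinc t\<bar> \<le> 1"
  by (simp add: sinc_def)

text \<open>The expression is the numerator of the derivative of \<open>sin x / x\<close>, whose
  denominator is \<open>x^2\<close>; the derivative is therefore bounded by 1.\<close>

lemma abs_x_cos_minus_sin_le:
  fixes x :: real
  assumes "0 \<le> x"
  shows "\<bar>x * cos x - sin x\<bar> \<le> x\<^sup>2"
proof (cases "x = 0")
  case False
  then have x: "0 < x" using assms by simp
  have "\<exists>z. 0 < z \<and> z < x \<and> (x * cos x - sin x) - (0 * cos 0 - sin 0) = (x - 0) * (- z * sin z)"
    by (rule MVT2[OF x]) (auto intro!: derivative_eq_intros)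
  then obtain z where z: "0 < z" "z < x" "x * cos x - sin x = x * (- z * sin z)" by auto
  have "\<bar>x * cos x - sin x\<bar> = x * (z * \<bar>sin z\<bar>)"
    using z x by (simp add: abs_mult)
  also have "\<dots> \<le> x * (x * 1)"
    using z x by (intro mult_left_mono mult_mono) auto
  finally show ?thesis by (simp add: power2_eq_square)
qed simp

lemma abs_sinc_diff_le:
  assumes "0 \<le> s" "s \<le> t"
  shows "\<bar>sinc t - sinc s\<bar> \<le> t - s"
proof -
  have pos: "\<bar>sinc t - sinc s\<bar> \<le> t - s" if "0 < s" "s < t" for s t
  proof -
    have "\<exists>z. s < z \<and> z < t \<and> sin t / t - sin s / s = (t - s) * ((z * cos z - sin z) / z\<^sup>2)"
      using that by (intro MVT2) (auto intro!: derivative_eq_intros simp: power2_eq_square field_simps)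
    then obtain z where z: "s < z" "z < t"
      and eq: "sin t / t - sin s / s = (t - s) * ((z * cos z - sin z) / z\<^sup>2)" by blast
    have "\<bar>(z * cos z - sin z) / z\<^sup>2\<bar> \<le> 1"
      using abs_x_cos_minus_sin_le[of z] z that by (simp add: abs_divide divide_le_eq)
    then show ?thesis
      using that mult_left_mono[of "\<bar>(z * cos z - sin z) / z\<^sup>2\<bar>" 1 "t - s"]
      by (simp add: sinc_def eq abs_mult)
  qed
  show ?thesis
  proof (cases "s = 0 \<and> t > 0")
    case True
    \<comment> \<open>The removable singularity is reached as a limit of the case of positive
      arguments; dividing by \<open>n + 2\<close> keeps the points strictly between 0 and
      \<open>t\<close>.\<close>
    have "(\<lambda>n. sinc (t / real (n + 2))) \<longlonglongrightarrow> 1"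
    proof -
      have "((\<lambda>x::real. sin x / x) \<longlongrightarrow> 1) (at 0)"
        using DERIV_sin[of 0] by (simp add: DERIV_def)
      moreover have "filterlim (\<lambda>n. t / real (n + 2)) (at 0) sequentially"
        using True 
        by (intro filterlim_atI LIMSEQ_ignore_initial_segment[OF lim_const_over_n]) auto
      ultimately have "(\<lambda>n. sin (t / real (n + 2)) / (t / real (n + 2))) \<longlonglongrightarrow> 1"
        by (rule filterlim_compose)
      then show ?thesis using True by (simp add: sinc_def)
    qed
    then have "(\<lambda>n. \<bar>sinc t - sinc (t / real (n + 2))\<bar>) \<longlonglongrightarrow> \<bar>sinc t - 1\<bar>"
      by (intro tendsto_intros)
    then have "\<bar>sinc t - 1\<bar> \<le> t"
    proof (rule LIMSEQ_le_const2)
      show "\<exists>N. \<forall>n\<ge>N. \<bar>sinc t - sinc (t / real (n + 2))\<bar> \<le> t"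
      proof (intro exI allI impI)
        fix n :: nat
        have "t / real (n + 2) < t" "0 < t / real (n + 2)"
          using True by (auto simp: divide_less_eq)
        from pos[OF this(2,1)] this show "\<bar>sinc t - sinc (t / real (n + 2))\<bar> \<le> t" by linarith
      qed
    qed
    then show ?thesis using True by (simp add: sinc_def)
  next
    case False
    then show ?thesis using pos assms by (cases "s = t") auto
  qed
qed

text \<open>The bound has to be independent of \<open>N\<close>. Below \<open>k = N\<close> the
  Lipschitz bound gives \<open>N\<close> differences of size at most \<open>2 / N\<close>; from
  \<open>N\<close> on, the decay of sinc gives a telescoping majorant with sum at most 4. The total
  6 is rounded up to 8.\<close>

lemma sinc_square_variation:
  fixes N :: nat
  assumes "N \<ge> 1"
  shows "(\<Sum>k<n. \<bar>(sinc (real k / N))\<^sup>2 - (sinc (real (Suc k) / N))\<^sup>2\<bar>) \<le> 8"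
proof -
  let ?d = "\<lambda>k. \<bar>(sinc (real k / N))\<^sup>2 - (sinc (real (Suc k) / N))\<^sup>2\<bar>"
  have N: "real N > 0" using assms by simp
  have fact: "?d k = \<bar>sinc (real k / N) - sinc (real (Suc k) / N)\<bar> *
      \<bar>sinc (real k / N) + sinc (real (Suc k) / N)\<bar>" for k
    by (simp add: power2_eq_square abs_mult[symmetric] algebra_simps)
  have small: "?d k \<le> 2 / N" for k
  proof -
    have "\<bar>sinc (real k / N) - sinc (real (Suc k) / N)\<bar> \<le> 1 / N"
      using abs_sinc_diff_le[of "real k / N" "real (Suc k) / N"] N
      by (simp add: abs_minus_commute divide_right_mono diff_divide_distrib[symmetric])
    moreover have "\<bar>sinc (real k / N) + sinc (real (Suc k) / N)\<bar> \<le> 2"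
      using abs_sinc_le_1[of "real k / N"] abs_sinc_le_1[of "real (Suc k) / N"] by linarith
    ultimately have "?d k \<le> 1 / N * 2" unfolding fact using N by (intro mult_mono) auto
    then show ?thesis by simp
  qed
  have large: "?d k \<le> 4 * N * (1 / real k - 1 / real (Suc k))" if "k \<ge> 1" for k
  proof -
    define t where "t = real k / N"
    define h where "h = 1 / real N"
    have t: "t > 0" "h > 0" using that N by (auto simp: t_def h_def)
    have th: "real (Suc k) / N = t + h" by (simp add: t_def h_def add_divide_distrib)
    have "\<bar>sinc t - sinc (t + h)\<bar> \<le> 2 * h / (t + h)"
    proof -
      have "sinc t - sinc (t + h) = (sinc t * h + (sin t - sin (t + h))) / (t + h)"
        using t by (simp add: sinc_def divide_simps) (simp add: algebra_simps)
      moreover have "\<bar>sinc t * h + (sin t - sin (t + h))\<bar> \<le> 2 * h"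
      proof -
        have "\<bar>sinc t * h\<bar> \<le> h" using abs_sinc_le_1[of t] t by (simp add: abs_mult)
        moreover have "\<bar>sin t - sin (t + h)\<bar> \<le> h"
        proof -
          have "\<exists>z. t < z \<and> z < t + h \<and> sin (t + h) - sin t = (t + h - t) * cos z"
            using t by (intro MVT2) (auto intro!: derivative_eq_intros)
          then obtain z where "sin (t + h) - sin t = h * cos z" by auto
          then have "\<bar>sin t - sin (t + h)\<bar> = h * \<bar>cos z\<bar>"
            using t by (metis abs_minus_commute abs_mult abs_of_pos)
          then show ?thesis using t by (simp add: mult_left_le)
        qed
        ultimately show ?thesis by linarith
      qed
      ultimately show ?thesis using t by (simp add: abs_divide divide_right_mono)
    qed
    moreover have "\<bar>sinc t + sinc (t + h)\<bar> \<le> 2 / t"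
    proof -
      have "\<bar>sinc t\<bar> \<le> 1 / t" using abs_t_sinc_le_1[of t] t by (simp add: field_simps abs_mult)
      moreover have "\<bar>sinc (t + h)\<bar> \<le> 1 / (t + h)"
        using abs_t_sinc_le_1[of "t + h"] t by (simp add: field_simps abs_mult)
      moreover have "1 / (t + h) \<le> 1 / t" using t by (simp add: frac_le)
      ultimately have "\<bar>sinc t\<bar> + \<bar>sinc (t + h)\<bar> \<le> 1 / t + 1 / t" by linarith
      then show ?thesis by (intro order_trans[OF abs_triangle_ineq]) simp
    qed
    ultimately have "?d k \<le> (2 * h / (t + h)) * (2 / t)"
      unfolding fact unfolding th t_def[symmetric] using t by (intro mult_mono) auto
    also have "\<dots> = 4 * N * (1 / real k - 1 / real (Suc k))"
      using that N by (simp add: t_def h_def divide_simps)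
    finally show ?thesis .
  qed
  \<comment> \<open>Enlarging the range to \<open>N + n\<close> allows the cut at \<open>N\<close>
    without comparing \<open>n\<close> with \<open>N\<close>.\<close>
  have "(\<Sum>k<n. ?d k) \<le> (\<Sum>k<N + n. ?d k)" by (intro sum_mono2) auto
  also have "\<dots> = (\<Sum>k<N. ?d k) + (\<Sum>k=N..<N+n. ?d k)"
    by (metis (no_types, lifting) atLeast0LessThan le_add1 sum.atLeastLessThan_concat zero_le)
  also have "(\<Sum>k<N. ?d k) \<le> (\<Sum>k<N. 2 / N)" by (intro sum_mono small)
  also have "(\<Sum>k=N..<N+n. ?d k) \<le> (\<Sum>k=N..<N+n. 4 * N * (1 / real k - 1 / real (Suc k)))"
    using assms by (intro sum_mono large) auto
  also have "(\<Sum>k=N..<N+n. 4 * N * (1 / real k - 1 / real (Suc k))) = 4 * N * (1 / N - 1 / (N + n))"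
  proof -
    have "(\<Sum>k=N..<N+n. 1 / real k - 1 / real (Suc k)) = 1 / N - 1 / (N + n)"
      by (induction n) auto
    then show ?thesis by (simp only: sum_distrib_left[symmetric])
  qed
  also have "\<dots> \<le> 4" using N by (simp add: right_diff_distrib)
  finally show ?thesis using N by simp
qed


subsection \<open>Schwarz derivatives\<close>

text \<open>Schwarz's argument: after a small convex parabola vanishing at both ends is added, a
  positive value still forces an interior maximum. There the second difference is nonpositive, so
  that of \<open>u\<close> is at most \<open>-2 \<epsilon> h^2\<close>, against the limit 0.\<close>

lemma second_difference_null_imp_nonpos:
  fixes u :: "real \<Rightarrow> real"
  assumes "a < b" and cont: "continuous_on {a..b} u"
    and ends: "u a = 0" "u b = 0"
    and diff: "\<And>x. a < x \<Longrightarrow> x < b \<Longrightarrow>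
      (\<lambda>N. (u (x + 1 / real (Suc N)) + u (x - 1 / real (Suc N)) - 2 * u x) * (real (Suc N))\<^sup>2) \<longlonglongrightarrow> 0"
    and x1: "a \<le> x1" "x1 \<le> b"
  shows "u x1 \<le> 0"
proof (rule ccontr)
  assume "\<not> u x1 \<le> 0"
  then have pos: "u x1 > 0" by simp
  \<comment> \<open>The parabola is at least \<open>-\<epsilon> (b - a)^2\<close> on the interval,
    so this choice lowers \<open>u x1\<close> by at most half of its value.\<close>
  define \<epsilon> where "\<epsilon> = u x1 / (2 * (b - a)\<^sup>2)"
  have \<epsilon>: "\<epsilon> > 0" using pos \<open>a < b\<close> by (simp add: \<epsilon>_def)
  define v where "v x = u x + \<epsilon> * ((x - a) * (x - b))" for x
  have contv: "continuous_on {a..b} v" unfolding v_def by (intro continuous_intros cont)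
  obtain x0 where x0: "x0 \<in> {a..b}" and max: "\<And>y. y \<in> {a..b} \<Longrightarrow> v y \<le> v x0"
    using continuous_attains_sup[OF compact_Icc _ contv] \<open>a < b\<close> by auto
  have "(x1 - a) * (b - x1) \<le> (b - a) * (b - a)" using x1 by (intro mult_mono) auto
  then have "\<epsilon> * ((x1 - a) * (b - x1)) \<le> \<epsilon> * ((b - a) * (b - a))"
    using \<epsilon> by (intro mult_left_mono) auto
  also have "\<epsilon> * ((b - a) * (b - a)) = u x1 / 2"
    using \<open>a < b\<close> by (simp add: \<epsilon>_def power2_eq_square)
  finally have "v x1 > 0" using pos unfolding v_def by (simp add: algebra_simps)
  moreover have "v a = 0" "v b = 0" using ends by (auto simp: v_def)
  ultimately have x0': "a < x0" "x0 < b"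
    using max[of x1] x0 x1 by (metis atLeastAtMost_iff less_le not_le)+
  define r where "r = min (x0 - a) (b - x0)"
  have r: "r > 0" using x0' by (simp add: r_def)
  let ?q = "\<lambda>N. (u (x0 + 1 / real (Suc N)) + u (x0 - 1 / real (Suc N)) - 2 * u x0) * (real (Suc N))\<^sup>2"
  have "\<forall>\<^sub>F N in sequentially. 1 / real (Suc N) < r"
    using lim_inverse_n'[THEN LIMSEQ_Suc] r by (auto elim!: order_tendstoD)
  moreover have "\<forall>\<^sub>F N in sequentially. ?q N > - 2 * \<epsilon>"
    using diff[OF x0'] \<epsilon> by (auto elim!: order_tendstoD)
  ultimately have "\<forall>\<^sub>F N in sequentially. False"
  proof eventually_elim
    case (elim N)
    define h where "h = 1 / real (Suc N)"
    have h: "h > 0" "h < r" using elim by (auto simp: h_def)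
    have "v (x0 + h) \<le> v x0" "v (x0 - h) \<le> v x0"
      using h by (auto intro!: max simp: r_def)
    then have "u (x0 + h) + u (x0 - h) - 2 * u x0 \<le> - 2 * \<epsilon> * h\<^sup>2"
      unfolding v_def by (simp add: algebra_simps power2_eq_square)
    then have "(u (x0 + h) + u (x0 - h) - 2 * u x0) * (real (Suc N))\<^sup>2 \<le> - 2 * \<epsilon> * h\<^sup>2 * (real (Suc N))\<^sup>2"
      by (intro mult_right_mono) auto
    also have "\<dots> = - 2 * \<epsilon>" by (simp add: h_def power2_eq_square)
    finally show ?case using elim(2) unfolding h_def by linarith
  qed
  then show False by simp
qed

text \<open>Subtracting the chord makes both end values zero and leaves second differences
  unchanged; the sign \<open>\<sigma>\<close> yields both inequalities.\<close>

lemma second_difference_null_imp_linear: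
  fixes u :: "real \<Rightarrow> real"
  assumes "a < b" and cont: "continuous_on {a..b} u"
    and diff: "\<And>x. a < x \<Longrightarrow> x < b \<Longrightarrow>
      (\<lambda>N. (u (x + 1 / real (Suc N)) + u (x - 1 / real (Suc N)) - 2 * u x) * (real (Suc N))\<^sup>2) \<longlonglongrightarrow> 0"
    and x: "a \<le> x" "x \<le> b"
  shows "u x = u a + (x - a) * ((u b - u a) / (b - a))"
proof -
  define s where "s = (u b - u a) / (b - a)"
  define w where "w \<sigma> x = \<sigma> * (u x - u a - (x - a) * s)" for \<sigma> x
  have "w \<sigma> x \<le> 0" for \<sigma>
  proof (rule second_difference_null_imp_nonpos[OF \<open>a < b\<close> _ _ _ _ x])
    show "continuous_on {a..b} (w \<sigma>)" unfolding w_def by (intro continuous_intros cont)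
    show "w \<sigma> a = 0" "w \<sigma> b = 0" using \<open>a < b\<close> by (auto simp: w_def s_def)
    fix y assume "a < y" "y < b"
    from tendsto_mult_left[OF diff[OF this], of \<sigma>]
    show "(\<lambda>N. (w \<sigma> (y + 1 / real (Suc N)) + w \<sigma> (y - 1 / real (Suc N)) - 2 * w \<sigma> y) * (real (Suc N))\<^sup>2) \<longlonglongrightarrow> 0"
      by (simp add: w_def algebra_simps)
  qed
  from this[of 1] this[of "-1"] show ?thesis by (simp add: w_def s_def)
qed

lemma second_difference_tendsto:
  fixes G :: "real \<Rightarrow> real"
  assumes x: "a < x" "x < b"
    and G: "\<And>y. a \<le> y \<Longrightarrow> y \<le> b \<Longrightarrow> (G has_real_derivative G1 y) (at y)"
    and G1: "\<And>y. a \<le> y \<Longrightarrow> y \<le> b \<Longrightarrow> (G1 has_real_derivative g y) (at y)"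
    and g: "isCont g x"
  shows "(\<lambda>N. (G (x + 1 / real (Suc N)) + G (x - 1 / real (Suc N)) - 2 * G x) * (real (Suc N))\<^sup>2) \<longlonglongrightarrow> g x"
proof (rule LIMSEQ_I)
  fix e :: real assume "e > 0"
  obtain d where d: "d > 0" "\<And>y. \<bar>y - x\<bar> < d \<Longrightarrow> \<bar>g y - g x\<bar> < e"
    using g \<open>e > 0\<close> unfolding continuous_at_eps_delta dist_real_def by (metis)
  define r where "r = min d (min (x - a) (b - x))"
  have r: "r > 0" using d x by (simp add: r_def)
  have "\<forall>\<^sub>F N in sequentially. 1 / real (Suc N) < r"
    using lim_inverse_n'[THEN LIMSEQ_Suc] r by (auto elim!: order_tendstoD)
  then obtain N0 where N0: "\<And>N. N \<ge> N0 \<Longrightarrow> 1 / real (Suc N) < r"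
    by (auto simp: eventually_sequentially)
  show "\<exists>no. \<forall>N\<ge>no. norm ((G (x + 1 / real (Suc N)) + G (x - 1 / real (Suc N)) - 2 * G x) * (real (Suc N))\<^sup>2 - g x) < e"
  proof (rule exI[of _ N0], intro allI impI)
    fix N assume "N \<ge> N0"
    define h where "h = 1 / real (Suc N)"
    have h: "h > 0" "h < r" using N0[OF \<open>N \<ge> N0\<close>] by (auto simp: h_def)
    define diff where "diff m = (if m = 0 then G else if m = 1 then G1 else g)" for m :: nat
    have D: "\<forall>m t. m < 2 \<and> a \<le> t \<and> t \<le> b \<longrightarrow> DERIV (diff m) t :> diff (Suc m) t"
      using G G1 by (auto simp: diff_def less_2_cases_iff)
    obtain t1 where t1: "x < t1" "t1 < x + h" "G (x + h) = G x + G1 x * h + g t1 / 2 * h\<^sup>2"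
      using Taylor[of 2 diff G a b x "x + h", OF _ _ D] h x
      by (auto simp: diff_def r_def numeral_2_eq_2)
    obtain t2 where t2: "x - h < t2" "t2 < x" "G (x - h) = G x - G1 x * h + g t2 / 2 * h\<^sup>2"
      using Taylor[of 2 diff G a b x "x - h", OF _ _ D] h x
      by (auto simp: diff_def r_def numeral_2_eq_2)
    have "(G (x + h) + G (x - h) - 2 * G x) * (real (Suc N))\<^sup>2 = (g t1 + g t2) / 2 * (h * real (Suc N))\<^sup>2"
      unfolding t1 t2 by (simp only: power_mult_distrib) algebra
    also have "h * real (Suc N) = 1" by (simp add: h_def)
    finally have eq: "(G (x + h) + G (x - h) - 2 * G x) * (real (Suc N))\<^sup>2 = (g t1 + g t2) / 2" by simp
    have "\<bar>g t1 - g x\<bar> < e" "\<bar>g t2 - g x\<bar> < e"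
      using t1 t2 h by (auto intro!: d simp: r_def)
    then show "norm ((G (x + 1 / real (Suc N)) + G (x - 1 / real (Suc N)) - 2 * G x) * (real (Suc N))\<^sup>2 - g x) < e"
      unfolding h_def[symmetric] eq real_norm_def abs_less_iff by (auto simp: field_simps)
  qed
qed

text \<open>A second primitive \<open>G\<close> of \<open>g\<close> has the same symmetric second
  derivative as \<open>F\<close>, so \<open>F - G\<close> is linear and \<open>F\<close> inherits
  the smoothness of \<open>G\<close>.\<close>

lemma second_difference_imp_twice_differentiable:
  fixes F g :: "real \<Rightarrow> real"
  assumes "a < b" and F: "continuous_on {a..b} F" and g: "continuous_on UNIV g"
    and diff: "\<And>x. (\<lambda>N. (F (x + 1 / real (Suc N)) + F (x - 1 / real (Suc N)) - 2 * F x) * (real (Suc N))\<^sup>2) \<longlonglongrightarrow> g x"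
  shows "\<exists>F1. \<forall>x. a < x \<and> x < b \<longrightarrow>
    (F has_real_derivative F1 x) (at x) \<and> (F1 has_real_derivative g x) (at x)"
proof -
  have antideriv: "\<exists>G. \<forall>x\<in>{c<..<d}. (G has_real_derivative h x) (at x)"
    if h: "continuous_on {c..d} h" for c d and h :: "real \<Rightarrow> real"
  proof -
    obtain G where G: "\<And>x. x \<in> {c..d} \<Longrightarrow> (G has_vector_derivative h x) (at x within {c..d})"
      using antiderivative_continuous[OF h] by blast
    have "(G has_real_derivative h x) (at x)" if "x \<in> {c<..<d}" for x
    proof -
      have "at x within {c..d} = at x"
        using that by (intro at_within_interior) (auto simp: interior_atLeastAtMost_real)
      then show ?thesis
        using G[of x] that by (simp add: has_real_derivative_iff_has_vector_derivative)
    qed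
    then show ?thesis by blast
  qed
  \<comment> \<open>Each integration gives two-sided derivatives only inside its interval; the
    margins 2 and then 1 are used up so that \<open>G\<close> is still differentiable at
    \<open>a\<close> and \<open>b\<close>.\<close>
  obtain G1 where G1: "\<And>x. x \<in> {a - 2<..<b + 2} \<Longrightarrow> (G1 has_real_derivative g x) (at x)"
    using antideriv[of "a - 2" "b + 2" g] continuous_on_subset[OF g] by blast
  have contG1: "continuous_on {a - 1..b + 1} G1"
    by (rule DERIV_continuous_on[of _ _ g]) (auto intro!: has_field_derivative_at_within[OF G1])
  obtain G where G: "\<And>x. x \<in> {a - 1<..<b + 1} \<Longrightarrow> (G has_real_derivative G1 x) (at x)"
    using antideriv[OF contG1] by blast
  have contG: "continuous_on {a..b} G"
    by (rule DERIV_continuous_on[of _ _ G1]) (auto intro!: has_field_derivative_at_within[OF G])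
  define u where "u x = F x - G x" for x
  define s where "s = (u b - u a) / (b - a)"
  have lin: "u x = u a + (x - a) * s" if "a \<le> x" "x \<le> b" for x
    unfolding s_def
  proof (rule second_difference_null_imp_linear[OF \<open>a < b\<close> _ _ that])
    show "continuous_on {a..b} u" unfolding u_def by (intro continuous_intros F contG)
    fix x assume x: "a < x" "x < b"
    have "(\<lambda>N. (G (x + 1 / real (Suc N)) + G (x - 1 / real (Suc N)) - 2 * G x) * (real (Suc N))\<^sup>2) \<longlonglongrightarrow> g x"
      by (rule second_difference_tendsto[OF x, of G G1])
         (use G G1 g in \<open>auto simp: continuous_on_eq_continuous_at\<close>)
    from tendsto_diff[OF diff[of x] this]
    show "(\<lambda>N. (u (x + 1 / real (Suc N)) + u (x - 1 / real (Suc N)) - 2 * u x) * (real (Suc N))\<^sup>2) \<longlonglongrightarrow> 0"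
      by (simp add: u_def algebra_simps)
  qed
  have "(F has_real_derivative (G1 x + s)) (at x) \<and> ((\<lambda>x. G1 x + s) has_real_derivative g x) (at x)"
    if x: "a < x" "x < b" for x
  proof
    have "((\<lambda>x. G x + (u a + (x - a) * s)) has_real_derivative (G1 x + s)) (at x)"
      using x by (auto intro!: derivative_eq_intros G[of x])
    moreover have "G y + (u a + (y - a) * s) = F y" if "y \<in> {a<..<b}" for y
      using lin[of y] that by (simp add: u_def)
    ultimately show "(F has_real_derivative (G1 x + s)) (at x)"
      using has_field_derivative_transform_within_open[of _ "G1 x + s" x "{a<..<b}" F] x by auto
    show "((\<lambda>x. G1 x + s) has_real_derivative g x) (at x)"
      using DERIV_add[OF G1[of x] DERIV_const[of s]] x by simp
  qed
  then show ?thesis by (intro exI[of _ "\<lambda>x. G1 x + s"]) simp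
qed


subsection \<open>The theorem of du Bois-Reymond\<close>

text \<open>Dividing the factor by \<open>- (k d)^2\<close>, that is by the sign and denominator of
  the integrated series and the squared step, gives the square of \<open>sinc (k d / 2)\<close>.
  This is the origin of the weights in the summation method.\<close>

lemma trig_term_second_difference:
  "trig_term c k (x + d) + trig_term c k (x - d) - 2 * trig_term c k x =
     - (4 * of_real ((sin (real k * d / 2))\<^sup>2)) * trig_term c k x"
proof -
  have shift: "cis (y + e) + cis (y - e) - 2 * cis y = - (4 * of_real ((sin (e / 2))\<^sup>2)) * cis y" for y e
  proof -
    have "cis (y + e) + cis (y - e) = 2 * of_real (cos e) * cis y"
      by (simp add: complex_eq_iff cos_add cos_diff sin_add sin_diff)
    also have "cos e = 1 - 2 * (sin (e / 2))\<^sup>2"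
      using cos_double_sin[of "e / 2"] by simp
    finally show ?thesis by (simp add: algebra_simps)
  qed
  have "trig_term c k (x + d) + trig_term c k (x - d) - 2 * trig_term c k x =
      c (int k) * (cis (real k * x + real k * d) + cis (real k * x - real k * d) - 2 * cis (real k * x)) +
      c (- int k) * (cis (- (real k * x) + real k * d) + cis (- (real k * x) - real k * d) - 2 * cis (- (real k * x)))"
    by (simp add: trig_term_def ring_distribs)
  also have "\<dots> = - (4 * of_real ((sin (real k * d / 2))\<^sup>2)) * trig_term c k x"
    by (simp only: shift) (simp add: trig_term_def algebra_simps)
  finally show ?thesis .
qed

text \<open>Riemann's method: the twice formally integrated series \<open>F\<close> converges uniformly, its second
  symmetric derivative is \<open>f - c 0\<close>, and by Schwarz's theorem \<open>F\<close> is twice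
  differentiable in the ordinary sense, so that its Fourier coefficients determine those of \<open>f\<close>.\<close>
theorem trig_series_coeffs:
  fixes f :: "real \<Rightarrow> complex" and c :: "int \<Rightarrow> complex" and k :: int
  assumes conv: "\<And>x. (\<lambda>n. trig_sum c n x) \<longlonglongrightarrow> f x" and f: "continuous_on UNIV f"
  shows "((\<lambda>x. f x * cis (- (of_int k * x))) has_integral 2 * pi * c k) {-pi..pi}"
proof -
  obtain B where B: "\<And>k. norm (c k) \<le> B"
    using trig_series_coeffs_bounded[of c] conv by (auto simp: convergent_def)
  define q where "q j x = trig_term c (Suc j) x / of_nat ((Suc j)\<^sup>2)" for j x
  \<comment> \<open>The constant term is left out: its second primitive, a multiple of
    \<open>x^2\<close>, would destroy periodicity.\<close>
  define F where "F x = - (\<Sum>j. q j x)" for x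
  have qB: "norm (q j x) \<le> 2 * B * inverse (real (Suc j) ^ 2)" for j x
  proof -
    have "norm (trig_term c (Suc j) x) \<le> B + B"
      unfolding trig_term_def
      by (intro order_trans[OF norm_triangle_ineq] add_mono) (simp_all only: norm_mult norm_cis mult_1_right B)
    then show ?thesis
      by (simp add: q_def norm_divide norm_power divide_right_mono flip: divide_inverse del: of_nat_Suc)
  qed
  have summ: "summable (\<lambda>j. 2 * B * inverse (real (Suc j) ^ 2))"
    using inverse_power_summable[of 2, where ?'a = real]
    by (intro summable_mult) (subst summable_Suc_iff, simp)
  have unif: "uniform_limit UNIV (\<lambda>n x. \<Sum>j<n. q j x) (\<lambda>x. \<Sum>j. q j x) sequentially"
    by (rule Weierstrass_m_test[OF qB summ])
  have q_sums: "(\<lambda>j. q j x) sums (- F x)" for x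
    unfolding F_def using summable_comparison_test'[OF summ qB] by (simp add: summable_sums)
  have contq: "continuous_on A (\<lambda>x. q j x)" for A j
    unfolding q_def trig_term_def by (intro continuous_intros) (auto simp del: of_nat_Suc)
  have contF: "continuous_on A F" for A
  proof -
    have "continuous_on UNIV (\<lambda>x. \<Sum>j. q j x)"
      by (rule uniform_limit_theorem[OF _ unif])
        (auto intro!: always_eventually continuous_on_sum contq)
    then show ?thesis unfolding F_def[abs_def]
      by (intro continuous_intros) (auto intro: continuous_on_subset)
  qed
  have diffF: "(\<lambda>N. (F (x + 1 / real (Suc N)) + F (x - 1 / real (Suc N)) - 2 * F x) * of_real ((real (Suc N))\<^sup>2))
      \<longlonglongrightarrow> f x - c 0" for x
  proof (rule regular_summation)
    \<comment> \<open>\<open>trig_term c 0 x\<close> would be \<open>2 * c 0\<close>; index 0 is set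
      to zero instead, and the sum is \<open>f x - c 0\<close>.\<close>
    define A where "A k = (if k = 0 then 0 else trig_term c k x)" for k
    define w where "w N k = (sinc (real k / real (2 * Suc N)))\<^sup>2" for N k
    show "A sums (f x - c 0)"
    proof -
      have "(\<lambda>n. trig_sum c n x - c 0) \<longlonglongrightarrow> f x - c 0"
        by (intro tendsto_diff conv tendsto_const)
      moreover have "trig_sum c n x - c 0 = (\<Sum>k<Suc n. A k)" for n
        by (simp add: trig_sum_conv_terms sum.lessThan_Suc_shift A_def del: sum.lessThan_Suc)
           (simp add: sum.atLeast1_atMost_eq)
      ultimately have "(\<lambda>n. \<Sum>k<Suc n. A k) \<longlonglongrightarrow> f x - c 0" by simp
      then show ?thesis unfolding sums_def by (rule LIMSEQ_imp_Suc)
    qed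
    show "w N 0 = 1" for N by (simp add: w_def sinc_def)
    show "\<bar>w N k\<bar> \<le> 1" for N k
      using abs_sinc_le_1 by (simp add: w_def abs_square_le_1)
    show "(\<lambda>N. w N k) \<longlonglongrightarrow> 1" for k
    proof -
      have "(\<lambda>N. sinc (real k / real (2 * Suc N)) - 1) \<longlonglongrightarrow> 0"
      proof (rule Lim_null_comparison)
        show "\<forall>\<^sub>F N in sequentially. norm (sinc (real k / real (2 * Suc N)) - 1) \<le> real k / 2 * inverse (real (Suc N))"
        proof (rule always_eventually, rule allI)
          fix N
          show "norm (sinc (real k / real (2 * Suc N)) - 1) \<le> real k / 2 * inverse (real (Suc N))"
            using abs_sinc_diff_le[of 0 "real k / real (2 * Suc N)"]
            by (simp add: sinc_def[of 0] field_simps)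
        qed
        show "(\<lambda>N. real k / 2 * inverse (real (Suc N))) \<longlonglongrightarrow> 0"
          using tendsto_mult_right_zero[OF LIMSEQ_inverse_real_of_nat, of "real k / 2"] by simp
      qed
      from tendsto_add[OF this tendsto_const[of 1]]
      have "(\<lambda>N. sinc (real k / real (2 * Suc N))) \<longlonglongrightarrow> 1" by simp
      from tendsto_power[OF this, of 2] show ?thesis by (simp add: w_def)
    qed
    show "(\<Sum>k<n. \<bar>w N k - w N (Suc k)\<bar>) \<le> 8" for N n
      unfolding w_def by (rule sinc_square_variation) simp
    show "(\<lambda>k. of_real (w N k) * A k) sums
       ((F (x + 1 / real (Suc N)) + F (x - 1 / real (Suc N)) - 2 * F x) * of_real ((real (Suc N))\<^sup>2))" for N
    proof -
      define d where "d = 1 / real (Suc N)"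
      have "(\<lambda>j. - of_real ((real (Suc N))\<^sup>2) * (q j (x + d) + q j (x - d) - 2 * q j x)) sums
          (- of_real ((real (Suc N))\<^sup>2) * (- F (x + d) + - F (x - d) - 2 * - F x))"
        by (intro sums_mult sums_add sums_diff q_sums)
      also have "(\<lambda>j. - of_real ((real (Suc N))\<^sup>2) * (q j (x + d) + q j (x - d) - 2 * q j x)) =
          (\<lambda>j. of_real (w N (Suc j)) * A (Suc j))"
      proof
        fix j
        have "q j (x + d) + q j (x - d) - 2 * q j x =
          (trig_term c (Suc j) (x + d) + trig_term c (Suc j) (x - d) - 2 * trig_term c (Suc j) x) / of_nat ((Suc j)\<^sup>2)"
          by (simp add: q_def add_divide_distrib diff_divide_distrib)
        also have "\<dots> = - (4 * of_real ((sin (real (Suc j) * d / 2))\<^sup>2)) * trig_term c (Suc j) x / of_nat ((Suc j)\<^sup>2)"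
          by (simp only: trig_term_second_difference)
        finally have 1: "- of_real ((real (Suc N))\<^sup>2) * (q j (x + d) + q j (x - d) - 2 * q j x) =
            of_real ((real (Suc N))\<^sup>2 * 4 * (sin (real (Suc j) * d / 2))\<^sup>2 / (real (Suc j))\<^sup>2) * A (Suc j)"
          by (simp add: A_def)
        have 2: "(real (Suc N))\<^sup>2 * 4 * (sin (real (Suc j) * d / 2))\<^sup>2 / (real (Suc j))\<^sup>2 = w N (Suc j)"
        proof -
          have "real (Suc j) * d / 2 = real (Suc j) / real (2 * Suc N)" by (simp add: d_def)
          then show ?thesis
            unfolding w_def sinc_def
            by (simp add: power_divide power_mult_distrib del: of_nat_Suc) (simp add: field_simps power2_eq_square)
        qed
        show "- of_real ((real (Suc N))\<^sup>2) * (q j (x + d) + q j (x - d) - 2 * q j x) =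
            of_real (w N (Suc j)) * A (Suc j)"
          unfolding 1 2 ..
      qed
      finally have "(\<lambda>k. of_real (w N k) * A k) sums
          (- of_real ((real (Suc N))\<^sup>2) * (- F (x + d) + - F (x - d) - 2 * - F x) + of_real (w N 0) * A 0)"
        by (subst (asm) sums_Suc_iff) (simp add: A_def)
      then show ?thesis
        by (simp only: d_def A_def) (simp add: algebra_simps)
    qed
  qed
  have perF: "F (x + 2 * pi) = F x" for x
  proof -
    have "trig_term c k (x + 2 * pi) = trig_term c k x" for k
      using cis_periodic[of "int k" x] cis_periodic[of "- int k" x] by (simp add: trig_term_def)
    then show ?thesis by (simp add: F_def q_def)
  qed
  \<comment> \<open>Schwarz's argument uses the order of the reals, hence the separate treatment of
    real and imaginary parts. The interval exceeds \<open>[-pi, pi]\<close> so that derivatives at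
    the endpoints are two-sided.\<close>
  obtain R1 where R1: "\<And>x. - (2 * pi) < x \<Longrightarrow> x < 2 * pi \<Longrightarrow>
      ((\<lambda>x. Re (F x)) has_real_derivative R1 x) (at x) \<and> (R1 has_real_derivative Re (f x - c 0)) (at x)"
  proof -
    have "\<exists>R1. \<forall>x. - (2 * pi) < x \<and> x < 2 * pi \<longrightarrow>
      ((\<lambda>x. Re (F x)) has_real_derivative R1 x) (at x) \<and> (R1 has_real_derivative Re (f x - c 0)) (at x)"
    proof (rule second_difference_imp_twice_differentiable)
      fix x
      show "(\<lambda>N. (Re (F (x + 1 / real (Suc N))) + Re (F (x - 1 / real (Suc N))) - 2 * Re (F x)) * (real (Suc N))\<^sup>2)
          \<longlonglongrightarrow> Re (f x - c 0)"
        using tendsto_Re[OF diffF[of x]] by (simp only: times_complex.sel Re_complex_of_real Im_complex_of_real plus_complex.sel minus_complex.sel complex_Re_numeral complex_Im_numeral) simp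
    qed (auto intro!: continuous_intros contF f)
    then show ?thesis using that by blast
  qed
  obtain I1 where I1: "\<And>x. - (2 * pi) < x \<Longrightarrow> x < 2 * pi \<Longrightarrow>
      ((\<lambda>x. Im (F x)) has_real_derivative I1 x) (at x) \<and> (I1 has_real_derivative Im (f x - c 0)) (at x)"
  proof -
    have "\<exists>R1. \<forall>x. - (2 * pi) < x \<and> x < 2 * pi \<longrightarrow>
      ((\<lambda>x. Im (F x)) has_real_derivative R1 x) (at x) \<and> (R1 has_real_derivative Im (f x - c 0)) (at x)"
    proof (rule second_difference_imp_twice_differentiable)
      fix x
      show "(\<lambda>N. (Im (F (x + 1 / real (Suc N))) + Im (F (x - 1 / real (Suc N))) - 2 * Im (F x)) * (real (Suc N))\<^sup>2)
          \<longlonglongrightarrow> Im (f x - c 0)"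
        using tendsto_Im[OF diffF[of x]] by (simp only: times_complex.sel Re_complex_of_real Im_complex_of_real plus_complex.sel minus_complex.sel complex_Re_numeral complex_Im_numeral) simp
    qed (auto intro!: continuous_intros contF f)
    then show ?thesis using that by blast
  qed
  define F1 where "F1 x = Complex (R1 x) (I1 x)" for x
  have dF: "(F has_vector_derivative F1 x) (at x)" if "- (2 * pi) < x" "x < 2 * pi" for x
    using R1[OF that] I1[OF that] by (simp add: has_vector_derivative_complex_iff F1_def)
  have dF1: "(F1 has_vector_derivative (f x - c 0)) (at x)" if "- (2 * pi) < x" "x < 2 * pi" for x
    using R1[OF that] I1[OF that] by (simp add: has_vector_derivative_complex_iff F1_def)
  have "F1 pi = F1 (- pi)"
  proof (rule vector_derivative_unique_at)
    show "(F has_vector_derivative F1 (- pi)) (at (- pi))" by (rule dF) auto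
    have "((\<lambda>x. x + 2 * pi) has_vector_derivative 1) (at (- pi))"
      unfolding has_vector_derivative_def by (auto intro!: derivative_eq_intros)
    then have "((\<lambda>x. F (x + 2 * pi)) has_vector_derivative F1 pi) (at (- pi))"
      using vector_diff_chain_at[of "\<lambda>x. x + 2 * pi" 1 "- pi" F "F1 pi"] dF[of pi]
      by (simp add: o_def)
    then show "(F has_vector_derivative F1 pi) (at (- pi))" by (simp add: perF)
  qed
  moreover have "F pi = F (- pi)" using perF[of "- pi"] by simp
  moreover have "cis (- (of_int k * pi)) = cis (- (of_int k * - pi))"
    using cis_periodic[of k "- pi"] cis_periodic[of "- k" "- pi"] by simp
  moreover define H where "H x = (F1 x + \<i> * of_int k * F x) * cis (- (of_int k * x))" for x
  ultimately have Hper: "H pi = H (- pi)" by (simp only: H_def)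
  \<comment> \<open>Two integrations by parts in a single antiderivative: in the derivative of
    \<open>H\<close> the terms with \<open>F1\<close> cancel, and equal end values make the integral
    zero.\<close>
  have "((\<lambda>x. (f x - c 0 + (of_int k)\<^sup>2 * F x) * cis (- (of_int k * x))) has_integral (H pi - H (- pi))) {-pi..pi}"
  proof (rule fundamental_theorem_of_calculus)
    fix x assume "x \<in> {-pi..pi}"
    then have "- pi \<le> x" "x \<le> pi" by auto
    with pi_gt_zero have x: "- (2 * pi) < x" "x < 2 * pi" by linarith+
    have "(cis \<circ> (\<lambda>x. - (of_int k * x)) has_vector_derivative (- of_int k *\<^sub>R (\<i> * cis (- (of_int k * x))))) (at x)"
      unfolding has_vector_derivative_def o_def
      by (auto intro!: derivative_eq_intros simp: fun_eq_iff scaleR_conv_of_real)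
    then have d: "((\<lambda>x. cis (- (of_int k * x))) has_vector_derivative (- of_int k * \<i> * cis (- (of_int k * x)))) (at x)"
      by (simp add: o_def scaleR_conv_of_real mult.assoc)
    have "(H has_vector_derivative ((F1 x + \<i> * of_int k * F x) * (- of_int k * \<i> * cis (- (of_int k * x)))
        + (f x - c 0 + \<i> * of_int k * F1 x) * cis (- (of_int k * x)))) (at x)"
      unfolding H_def[abs_def]
      by (intro has_vector_derivative_mult has_vector_derivative_add has_vector_derivative_mult_right
            dF[OF x] dF1[OF x] d)
    also have "((F1 x + \<i> * of_int k * F x) * (- of_int k * \<i> * cis (- (of_int k * x)))
        + (f x - c 0 + \<i> * of_int k * F1 x) * cis (- (of_int k * x))) =
        (f x - c 0 + (of_int k)\<^sup>2 * F x) * cis (- (of_int k * x))"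
      by (simp add: algebra_simps power2_eq_square)
    finally show "(H has_vector_derivative (f x - c 0 + (of_int k)\<^sup>2 * F x) * cis (- (of_int k * x))) (at x within {-pi..pi})"
      by (rule has_vector_derivative_at_within)
  qed simp
  then have int0: "((\<lambda>x. (f x - c 0 + (of_int k)\<^sup>2 * F x) * cis (- (of_int k * x))) has_integral 0) {-pi..pi}"
    by (simp add: Hper)
  have intF: "((\<lambda>x. F x * cis (- (of_int k * x))) has_integral
      (if k = 0 then 0 else - (2 * pi * c k / (of_int k)\<^sup>2))) {-pi..pi}"
  proof -
    have unif': "uniform_limit {-pi..pi} (\<lambda>n x. (\<Sum>j<n. q j x) * cis (- (of_int k * x)))
        (\<lambda>x. (\<Sum>j. q j x) * cis (- (of_int k * x))) sequentially"
    proof (rule uniform_limitI)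
      fix e :: real assume "e > 0"
      from uniform_limitD[OF unif this]
      show "\<forall>\<^sub>F n in sequentially. \<forall>x\<in>{-pi..pi}. dist ((\<Sum>j<n. q j x) * cis (- (of_int k * x)))
          ((\<Sum>j. q j x) * cis (- (of_int k * x))) < e"
        by eventually_elim (simp add: dist_norm left_diff_distrib[symmetric] norm_mult)
    qed
    obtain I J where I: "\<And>n. ((\<lambda>x. (\<Sum>j<n. q j x) * cis (- (of_int k * x))) has_integral I n) {-pi..pi}"
      and J: "((\<lambda>x. (\<Sum>j. q j x) * cis (- (of_int k * x))) has_integral J) {-pi..pi}" and IJ: "I \<longlonglongrightarrow> J"
      by (rule uniform_limit_integral[OF unif']) (auto intro!: continuous_intros contq)
    define v where "v j = (c (int (Suc j)) * (if int (Suc j) - k = 0 then 2 * pi else 0) +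
        c (- int (Suc j)) * (if - int (Suc j) - k = 0 then 2 * pi else 0)) / of_nat ((Suc j)\<^sup>2)" for j
    have intq: "((\<lambda>x. q j x * cis (- (of_int k * x))) has_integral v j) {-pi..pi}" for j
    proof -
      have "q j x * cis (- (of_int k * x)) = (c (int (Suc j)) * cis (of_int (int (Suc j) - k) * x) +
          c (- int (Suc j)) * cis (of_int (- int (Suc j) - k) * x)) / of_nat ((Suc j)\<^sup>2)" for x
        by (simp add: q_def trig_term_def ring_distribs mult.assoc cis_mult)
      moreover have "((\<lambda>x. (c (int (Suc j)) * cis (of_int (int (Suc j) - k) * x) +
          c (- int (Suc j)) * cis (of_int (- int (Suc j) - k) * x)) / of_nat ((Suc j)\<^sup>2)) has_integral
          (c (int (Suc j)) * (if int (Suc j) - k = 0 then 2 * pi else 0) +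
          c (- int (Suc j)) * (if - int (Suc j) - k = 0 then 2 * pi else 0)) / of_nat ((Suc j)\<^sup>2)) {-pi..pi}"
        by (intro has_integral_divide has_integral_add has_integral_mult_right has_integral_cis)
      ultimately show ?thesis by (simp only: v_def)
    qed
    have In: "I n = (\<Sum>j<n. v j)" for n
      using has_integral_sum[of "{..<n}" "\<lambda>j x. q j x * cis (- (of_int k * x))" v "{-pi..pi}"] intq I[of n]
      by (auto simp: sum_distrib_right[symmetric] intro: has_integral_unique)
    \<comment> \<open>Term \<open>j\<close> carries the frequencies \<open>j + 1\<close> and
      \<open>-(j + 1)\<close>. For \<open>k = 0\<close> the index
      \<open>nat \<bar>k\<bar> - 1\<close> truncates to 0, where the asserted value is 0 as
      well.\<close>
    have v: "v j = (if j = nat \<bar>k\<bar> - 1 then (if k = 0 then 0 else 2 * pi * c k / (of_int k)\<^sup>2) else 0)" for j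
      by (cases "k = 0"; cases "k > 0") (auto simp: v_def nat_diff_distrib power2_eq_square of_nat_diff algebra_simps)
    have "\<forall>\<^sub>F n in sequentially. I n = (if k = 0 then 0 else 2 * pi * c k / (of_int k)\<^sup>2)"
      using eventually_gt_at_top[of "nat \<bar>k\<bar>"]
      by eventually_elim (auto simp: In v)
    then have "J = (if k = 0 then 0 else 2 * pi * c k / (of_int k)\<^sup>2)"
      using IJ tendsto_eventually LIMSEQ_unique by blast
    then show ?thesis
      using has_integral_neg[OF J] by (auto simp: F_def)
  qed
  \<comment> \<open>Restoring \<open>c 0\<close> and removing \<open>k^2 F\<close> leaves
    \<open>f\<close>; the value comes from \<open>intF\<close> when \<open>k \<noteq> 0\<close> and
    from the constant term when \<open>k = 0\<close>.\<close>
  have "((\<lambda>x. (f x - c 0 + (of_int k)\<^sup>2 * F x) * cis (- (of_int k * x)) + c 0 * cis (of_int (- k) * x)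
       - (of_int k)\<^sup>2 * (F x * cis (- (of_int k * x)))) has_integral
      (0 + c 0 * (if - k = 0 then 2 * pi else 0)
       - (of_int k)\<^sup>2 * (if k = 0 then 0 else - (2 * pi * c k / (of_int k)\<^sup>2)))) {-pi..pi}"
    by (intro has_integral_diff has_integral_add has_integral_mult_right int0 intF has_integral_cis)
  then show ?thesis
    by (cases "k = 0") (simp_all add: algebra_simps)
qed


subsection \<open>Fejer means\<close>

text \<open>For \<open>m = 0\<close> this is the Cesaro mean of the series at the point 0; a general
  \<open>m\<close> shifts the frequencies. Grouping by \<open>j - l\<close> gives triangular weights
  that are 1 at the centre and add up to \<open>N\<close>.\<close>

definition fejer_mean :: "(int \<Rightarrow> complex) \<Rightarrow> int \<Rightarrow> nat \<Rightarrow> complex" where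
  "fejer_mean c m N = (\<Sum>j<N. \<Sum>l<N. c (m + int j - int l)) / of_nat N"

lemma sum_differences:
  fixes g :: "int \<Rightarrow> complex"
  shows "(\<Sum>j<N. \<Sum>l<N. g (int j - int l)) = (\<Sum>k = - int N..int N. of_int (int N - \<bar>k\<bar>) * g k)"
proof (induction N)
  case (Suc N)
  have "(\<Sum>j<Suc N. \<Sum>l<Suc N. g (int j - int l)) =
      (\<Sum>j<N. \<Sum>l<N. g (int j - int l)) + ((\<Sum>j<N. g (int j - int N)) + (\<Sum>l<Suc N. g (int N - int l)))"
    by (simp add: sum.distrib)
  also have "(\<Sum>j<N. g (int j - int N)) = (\<Sum>k = 1..N. g (- int k))"
    by (rule sum.reindex_bij_witness[of _ "\<lambda>k. N - k" "\<lambda>j. N - j"]) (auto simp: of_nat_diff)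
  also have "(\<Sum>l<Suc N. g (int N - int l)) = (\<Sum>k\<le>N. g (int k))"
    by (rule sum.reindex_bij_witness[of _ "\<lambda>k. N - k" "\<lambda>j. N - j"]) (auto simp: of_nat_diff)
  also have "(\<Sum>k\<le>N. g (int k)) = g 0 + (\<Sum>k = 1..N. g (int k))"
    by (simp add: sum.atMost_shift sum.atLeast1_atMost_eq)
  also have "(\<Sum>k = 1..N. g (- int k)) + (g 0 + (\<Sum>k = 1..N. g (int k))) = (\<Sum>k = - int N..int N. g k)"
    by (simp add: sum_symmetric_int sum.distrib)
  also have "(\<Sum>j<N. \<Sum>l<N. g (int j - int l)) + (\<Sum>k = - int N..int N. g k) =
      (\<Sum>k = - int N..int N. of_int (int (Suc N) - \<bar>k\<bar>) * g k)"
    by (simp add: Suc sum.distrib[symmetric] algebra_simps)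
  also have "\<dots> = (\<Sum>k = - int (Suc N)..int (Suc N). of_int (int (Suc N) - \<bar>k\<bar>) * g k)"
  proof (rule sum.mono_neutral_left)
    show "\<forall>i\<in>{- int (Suc N)..int (Suc N)} - {- int N..int N}. of_int (int (Suc N) - \<bar>i\<bar>) * g i = 0"
    proof
      fix i assume "i \<in> {- int (Suc N)..int (Suc N)} - {- int N..int N}"
      then have "int (Suc N) - \<bar>i\<bar> = 0" by auto
      then show "of_int (int (Suc N) - \<bar>i\<bar>) * g i = 0" by (simp only: of_int_0 mult_zero_left)
    qed
  qed auto
  finally show ?case .
qed simp

lemma fejer_mean_eq:
  "fejer_mean c m N = (\<Sum>k = - int N..int N. of_real ((real N - \<bar>of_int k\<bar>) / real N) * c (m + k))"
  using sum_differences[of "\<lambda>k. c (m + k)" N]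
  by (simp add: fejer_mean_def sum_divide_distrib algebra_simps flip: of_int_abs)

definition fejer_kernel :: "nat \<Rightarrow> real \<Rightarrow> real" where
  "fejer_kernel N x = (norm (\<Sum>j<N. cis (real j * x)))\<^sup>2 / real N"

lemma fejer_kernel_nonneg: "fejer_kernel N x \<ge> 0"
  by (simp add: fejer_kernel_def)

lemma fejer_kernel_le:
  assumes "0 < d" "d \<le> \<bar>x\<bar>" "\<bar>x\<bar> \<le> pi" "N \<ge> 1"
  shows "fejer_kernel N x \<le> 4 / ((2 - 2 * cos d) * real N)"
proof -
  let ?D = "\<Sum>j<N. cis (real j * x)"
  have "?D * (1 - cis x) = 1 - cis (real N * x)"
  proof (induction N)
    case (Suc N)
    have "cis (real N * x) * cis x = cis (real (Suc N) * x)"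
      by (simp add: cis_mult algebra_simps)
    moreover have "(\<Sum>j<Suc N. cis (real j * x)) * (1 - cis x) =
        (\<Sum>j<N. cis (real j * x)) * (1 - cis x) + (cis (real N * x) - cis (real N * x) * cis x)"
      by (simp add: ring_distribs)
    ultimately show ?case by (simp only: Suc) simp
  qed simp
  then have "norm ?D * norm (1 - cis x) \<le> 2"
    using norm_triangle_ineq4[of 1 "cis (real N * x)"] by (simp flip: norm_mult)
  then have "(norm ?D * norm (1 - cis x))\<^sup>2 \<le> 2\<^sup>2"
    by (intro power_mono) auto
  moreover have "(norm (1 - cis x))\<^sup>2 = 2 - 2 * cos x"
    using sin_cos_squared_add[of x] unfolding cmod_power2 by (simp add: power2_eq_square algebra_simps)
  ultimately have *: "(norm ?D)\<^sup>2 * (2 - 2 * cos x) \<le> 4" by (simp add: power_mult_distrib)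
  have "cos \<bar>x\<bar> \<le> cos d" using assms by (intro cos_monotone_0_pi_le) auto
  then have "(norm ?D)\<^sup>2 * (2 - 2 * cos d) \<le> (norm ?D)\<^sup>2 * (2 - 2 * cos x)"
    by (intro mult_left_mono) auto
  moreover have "cos d < cos 0" using assms by (intro cos_monotone_0_pi) auto
  ultimately have "(norm ?D)\<^sup>2 \<le> 4 / (2 - 2 * cos d)"
    using * by (simp add: pos_le_divide_eq)
  then have "fejer_kernel N x \<le> 4 / (2 - 2 * cos d) / real N"
    unfolding fejer_kernel_def using assms by (intro divide_right_mono) auto
  then show ?thesis by simp
qed

lemma has_integral_fejer_kernel_mult:
  fixes f :: "real \<Rightarrow> complex" and c :: "int \<Rightarrow> complex"
  assumes coeffs: "\<And>k :: int. ((\<lambda>x. f x * cis (- (of_int k * x))) has_integral 2 * pi * c k) {-pi..pi}"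
  shows "((\<lambda>x. f x * cis (- (of_int m * x)) * of_real (fejer_kernel N x)) has_integral
    2 * pi * fejer_mean c m N) {-pi..pi}"
proof -
  have "((\<lambda>x. (\<Sum>j<N. \<Sum>l<N. f x * cis (- (of_int (m + int j - int l) * x))) / of_nat N) has_integral
    (\<Sum>j<N. \<Sum>l<N. 2 * pi * c (m + int j - int l)) / of_nat N) {-pi..pi}"
    by (intro has_integral_divide has_integral_sum coeffs) auto
  moreover have "(\<Sum>j<N. \<Sum>l<N. f x * cis (- (of_int (m + int j - int l) * x))) / of_nat N =
      f x * cis (- (of_int m * x)) * of_real (fejer_kernel N x)" for x
  proof -
    have "of_real ((norm (\<Sum>j<N. cis (real j * x)))\<^sup>2) =
        (\<Sum>j<N. cis (- (real j * x))) * (\<Sum>l<N. cis (real l * x))"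
      by (simp only: complex_norm_square) (simp add: cis_cnj mult.commute)
    also have "\<dots> = (\<Sum>j<N. \<Sum>l<N. cis (- (real j * x) + real l * x))"
      by (simp only: sum_product cis_mult)
    finally have "of_real (fejer_kernel N x) = (\<Sum>j<N. \<Sum>l<N. cis (- (real j * x) + real l * x)) / of_nat N"
      by (simp add: fejer_kernel_def)
    then have "f x * cis (- (of_int m * x)) * of_real (fejer_kernel N x) =
      (\<Sum>j<N. \<Sum>l<N. f x * (cis (- (of_int m * x)) * cis (- (real j * x) + real l * x))) / of_nat N"
      by (simp add: sum_distrib_left mult.assoc)
    also have "\<dots> = (\<Sum>j<N. \<Sum>l<N. f x * cis (- (of_int (m + int j - int l) * x))) / of_nat N"
      by (simp only: cis_mult) (simp add: algebra_simps)
    finally show ?thesis ..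
  qed
  moreover have "(\<Sum>j<N. \<Sum>l<N. 2 * pi * c (m + int j - int l)) / of_nat N = 2 * pi * fejer_mean c m N"
    by (simp add: fejer_mean_def sum_distrib_left)
  ultimately show ?thesis by simp
qed

lemma has_integral_fejer_kernel:
  assumes "N \<ge> 1"
  shows "(fejer_kernel N has_integral 2 * pi) {-pi..pi}"
proof -
  \<comment> \<open>These are the Fourier coefficients of the constant function 1, to which the
    preceding lemma is applied.\<close>
  let ?d = "\<lambda>k :: int. if k = 0 then 1 else 0 :: complex"
  have "((\<lambda>x. 1 * cis (- (of_int 0 * x)) * of_real (fejer_kernel N x)) has_integral
      2 * pi * fejer_mean ?d 0 N) {-pi..pi}"
  proof (rule has_integral_fejer_kernel_mult)
    fix k :: int
    show "((\<lambda>x. 1 * cis (- (of_int k * x))) has_integral 2 * pi * ?d k) {-pi..pi}"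
      using has_integral_cis[of "- k"] by (auto split: if_splits)
  qed
  moreover have "fejer_mean ?d 0 N = 1"
  proof -
    have "(\<Sum>j<N. \<Sum>l<N. ?d (0 + int j - int l)) = (\<Sum>j<N. \<Sum>l<N. if j = l then 1 else 0)"
      by (intro sum.cong) auto
    then show ?thesis using assms by (simp add: fejer_mean_def)
  qed
  ultimately have "((\<lambda>x. complex_of_real (fejer_kernel N x)) has_integral 2 * pi) {-pi..pi}"
    by simp
  from has_integral_linear[OF this bounded_linear_Re] show ?thesis
    by (simp add: o_def)
qed

text \<open>The bound has two parts because near 0 only the function may be small, whereas away from
  0 it is the kernel that is small. With \<open>B' = 0\<close> it covers functions bounded by
  \<open>B\<close>.\<close>

lemma norm_fejer_mean_le:
  fixes f :: "real \<Rightarrow> complex" and c :: "int \<Rightarrow> complex"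
  assumes coeffs: "\<And>k :: int. ((\<lambda>x. f x * cis (- (of_int k * x))) has_integral 2 * pi * c k) {-pi..pi}"
    and bound: "\<And>x. \<bar>x\<bar> \<le> pi \<Longrightarrow> norm (f x) * fejer_kernel N x \<le> B * fejer_kernel N x + B'" and N: "N \<ge> 1"
  shows "norm (fejer_mean c m N) \<le> B + B'"
proof -
  have "((\<lambda>x. B * fejer_kernel N x + B') has_integral (B * (2 * pi) + B' * (2 * pi))) {-pi..pi}"
    using has_integral_const_real[of B' "-pi" pi]
    by (intro has_integral_add has_integral_mult_right has_integral_fejer_kernel[OF N]) (simp_all add: mult.commute)
  then have "norm (2 * pi * fejer_mean c m N) \<le> (B * (2 * pi) + B' * (2 * pi)) \<bullet> 1"
  proof (rule has_integral_norm_bound_integral_component[OF has_integral_fejer_kernel_mult[OF coeffs, of m N]])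
    fix x assume "x \<in> {-pi..pi}"
    then have "\<bar>x\<bar> \<le> pi" by auto
    from bound[OF this] show "norm (f x * cis (- (of_int m * x)) * of_real (fejer_kernel N x))
        \<le> (B * fejer_kernel N x + B') \<bullet> 1"
      using fejer_kernel_nonneg[of N x] by (simp add: norm_mult)
  qed
  then have "2 * pi * norm (fejer_mean c m N) \<le> 2 * pi * (B + B')"
    by (simp add: norm_mult algebra_simps)
  then show ?thesis by simp
qed

text \<open>Fejer's argument at the point 0, uniform in \<open>m\<close> because the modulating
  factor has modulus 1. Replacing \<open>f\<close> by \<open>f - f 0\<close> changes only the
  coefficient of index 0, and for \<open>m \<ge> N\<close> the block contains positive indices
  only.\<close>

lemma fejer_mean_tendsto_0:
  fixes f :: "real \<Rightarrow> complex" and c :: "int \<Rightarrow> complex"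
  assumes f: "continuous_on UNIV f"
    and coeffs: "\<And>k :: int. ((\<lambda>x. f x * cis (- (of_int k * x))) has_integral 2 * pi * c k) {-pi..pi}"
    and e: "e > 0"
  shows "\<exists>N0. \<forall>N\<ge>N0. \<forall>m. m \<ge> int N \<longrightarrow> norm (fejer_mean c m N) \<le> e"
proof -
  define c' where "c' k = c k - f 0 * (if k = 0 then 1 else 0)" for k
  have coeffs': "((\<lambda>x. (f x - f 0) * cis (- (of_int k * x))) has_integral 2 * pi * c' k) {-pi..pi}" for k :: int
  proof -
    have "((\<lambda>x. f x * cis (- (of_int k * x)) - f 0 * cis (of_int (- k) * x)) has_integral
        (2 * pi * c k - f 0 * (if - k = 0 then 2 * pi else 0))) {-pi..pi}"
      by (intro has_integral_diff has_integral_mult_right coeffs has_integral_cis)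
    then show ?thesis by (auto simp: c'_def algebra_simps split: if_splits)
  qed
  have "\<exists>d>0. \<forall>x. dist x 0 < d \<longrightarrow> dist (f x) (f 0) < e / 2"
    using f half_gt_zero[OF e] unfolding continuous_on_eq_continuous_at[OF open_UNIV] continuous_at_eps_delta
    by blast
  then obtain d where d: "d > 0" "\<And>x. \<bar>x\<bar> < d \<Longrightarrow> norm (f x - f 0) < e / 2"
    by (auto simp: dist_norm)
  \<comment> \<open>Capped at \<open>pi\<close>, where the monotonicity of the cosine used for the
    kernel bound ends.\<close>
  define d' where "d' = min d pi"
  have d': "0 < d'" "d' \<le> d" "d' \<le> pi" using d by (auto simp: d'_def)
  have "compact ((\<lambda>x. f x - f 0) ` {-pi..pi})"
    by (intro compact_continuous_image continuous_intros continuous_on_subset[OF f]) auto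
  then have "bounded ((\<lambda>x. f x - f 0) ` {-pi..pi})" by (rule compact_imp_bounded)
  then obtain R where "\<forall>x\<in>{-pi..pi}. norm (f x - f 0) \<le> R" by (auto simp: bounded_iff)
  then have R: "norm (f x - f 0) \<le> R" if "\<bar>x\<bar> \<le> pi" for x using that by (simp add: abs_le_iff)
  have R0: "R \<ge> 0" using R[of 0] by simp
  have "(\<lambda>N. R * 4 / (2 - 2 * cos d') / real N) \<longlonglongrightarrow> 0"
    by (rule lim_const_over_n)
  then have "\<forall>\<^sub>F N in sequentially. R * 4 / (2 - 2 * cos d') / real N < e / 2"
    using e by (intro order_tendstoD) auto
  then obtain N0 where N0: "\<And>N. N \<ge> N0 \<Longrightarrow> R * 4 / (2 - 2 * cos d') / real N < e / 2"
    by (auto simp: eventually_sequentially)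
  show ?thesis
  proof (rule exI[of _ "max N0 1"], intro allI impI)
    fix N m assume N: "max N0 1 \<le> N" and m: "int N \<le> m"
    have N1: "N \<ge> 1" using N by simp
    have eq: "fejer_mean c m N = fejer_mean c' m N"
      unfolding fejer_mean_def using m
      by (intro arg_cong2[of _ _ _ _ "(/)"] refl sum.cong) (auto simp: c'_def)
    have "norm (fejer_mean c' m N) \<le> e / 2 + R * 4 / (2 - 2 * cos d') / real N"
    proof (rule norm_fejer_mean_le[OF coeffs' _ N1])
      fix x :: real assume x: "\<bar>x\<bar> \<le> pi"
      have cd: "cos d' < cos 0" using d' by (intro cos_monotone_0_pi) auto
      show "norm (f x - f 0) * fejer_kernel N x \<le> e / 2 * fejer_kernel N x + R * 4 / (2 - 2 * cos d') / real N"
      proof (cases "\<bar>x\<bar> < d'")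
        case True
        then have "norm (f x - f 0) * fejer_kernel N x \<le> e / 2 * fejer_kernel N x"
          using d(2)[of x] d' by (intro mult_right_mono fejer_kernel_nonneg) auto
        moreover have "0 \<le> R * 4 / (2 - 2 * cos d') / real N" using R0 cd by simp
        ultimately show ?thesis by linarith
      next
        case False
        have "norm (f x - f 0) * fejer_kernel N x \<le> R * (4 / ((2 - 2 * cos d') * real N))"
          using False d' x N1 R0 by (intro mult_mono R fejer_kernel_le fejer_kernel_nonneg) auto
        moreover have "0 \<le> e / 2 * fejer_kernel N x" using e fejer_kernel_nonneg[of N x] by simp
        ultimately show ?thesis by (simp add: mult_ac)
      qed
    qed
    also have "\<dots> \<le> e" using N0[of N] N by simp
    finally show "norm (fejer_mean c m N) \<le> e" unfolding eq .
  qed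
qed


subsection \<open>Sequences of bounded block variation\<close>

text \<open>The maximum over the window is weakened to a sum, since sums can be interchanged with
  the averaging over starting points; \<open>N\<close> and \<open>M\<close> become explicit for use
  in later constants.\<close>

definition block_variation :: "(nat \<Rightarrow> complex) \<Rightarrow> nat \<Rightarrow> real \<Rightarrow> bool" where
  "block_variation c N M \<longleftrightarrow> N \<ge> 1 \<and> M > 0 \<and>
     (\<forall>m\<ge>1. (\<Sum>n = m..2 * m. norm (c n - c (Suc n))) \<le> M * (\<Sum>i<N. norm (c (m + i))))"

lemma block_variationD:
  "block_variation c N M \<Longrightarrow> m \<ge> 1 \<Longrightarrow>
    (\<Sum>n = m..2 * m. norm (c n - c (Suc n))) \<le> M * (\<Sum>i<N. norm (c (m + i)))"
  by (simp add: block_variation_def)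

lemma GBV_imp_block_variation:
  assumes "GBV c"
  shows "\<exists>N M. block_variation c N M"
proof -
  obtain N M where N: "N \<ge> 1" "M > 0" and *: "\<And>m. m \<ge> 1 \<Longrightarrow>
      (\<Sum>n = m..2 * m. norm (c n - c (Suc n))) \<le> M * Max ((\<lambda>n. norm (c n)) ` {m..<m + N})"
    using assms unfolding GBV_def by blast
  have "(\<Sum>n = m..2 * m. norm (c n - c (Suc n))) \<le> M * (\<Sum>i<N. norm (c (m + i)))" if "m \<ge> 1" for m
  proof -
    have "Max ((\<lambda>n. norm (c n)) ` {m..<m + N}) \<in> (\<lambda>n. norm (c n)) ` {m..<m + N}"
      using N by (intro Max_in) auto
    then obtain n where n: "n \<in> {m..<m + N}" "Max ((\<lambda>n. norm (c n)) ` {m..<m + N}) = norm (c n)"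
      by blast
    have "norm (c (m + (n - m))) \<le> (\<Sum>i<N. norm (c (m + i)))"
      using n by (intro member_le_sum) auto
    with n *[OF that] N show ?thesis
      by (smt (verit, ccfv_SIG) atLeastLessThan_iff le_add_diff_inverse mult_left_mono)
  qed
  then show ?thesis using N unfolding block_variation_def by blast
qed

text \<open>With \<open>\<kappa> = cos \<theta>\<close>, the sector condition becomes a linear
  inequality that survives sums with nonnegative weights.\<close>

lemma GBV_cone:
  assumes "GBV c"
  shows "\<exists>\<kappa>>0. \<forall>n\<ge>1. \<kappa> * norm (c n) \<le> Re (c n)"
proof -
  obtain \<theta> where \<theta>: "0 \<le> \<theta>" "\<theta> < pi / 2" and c: "\<And>n. n \<ge> 1 \<Longrightarrow> c n \<in> cone \<theta>"
    using assms unfolding GBV_def by auto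
  have "cos \<theta> * norm (c n) \<le> Re (c n)" if "n \<ge> 1" for n
  proof (cases "c n = 0")
    case False
    with c[OF that] have A: "\<bar>Arg (c n)\<bar> \<le> \<theta>" by (simp add: cone_def)
    have "Re (c n) = norm (c n) * cos (Arg (c n))"
      by (metis Re_rcis rcis_cmod_Arg)
    moreover have "cos \<theta> \<le> cos \<bar>Arg (c n)\<bar>"
      using A \<theta> by (intro cos_monotone_0_pi_le) auto
    ultimately show ?thesis by (simp add: mult.commute[of "cos \<theta>"] mult_left_mono)
  qed simp
  moreover have "cos \<theta> > 0" using \<theta> by (intro cos_gt_zero_pi) auto
  ultimately show ?thesis by blast
qed

lemma block_variation_le:
  assumes "block_variation c N M" and "1 \<le> m" "m \<le> n" "n \<le> 2 * m + 1"
  shows "norm (c n) \<le> (M + 1) * (\<Sum>i<N. norm (c (m + i)))"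
proof -
  from assms have N: "N \<ge> 1" and V: "(\<Sum>n = m..2 * m. norm (c n - c (Suc n))) \<le> M * (\<Sum>i<N. norm (c (m + i)))"
    by (auto simp: block_variation_def)
  have "c m - c n = (\<Sum>k=m..<n. c k - c (Suc k))"
    using \<open>m \<le> n\<close> by (induction n rule: dec_induct) (auto simp: diff_eq_eq)
  then have "norm (c m - c n) = norm (\<Sum>k=m..<n. c k - c (Suc k))" by simp
  also have "\<dots> \<le> (\<Sum>k=m..<n. norm (c k - c (Suc k)))" by (rule norm_sum)
  also have "\<dots> \<le> (\<Sum>k=m..2 * m. norm (c k - c (Suc k)))"
    using assms by (intro sum_mono2) auto
  finally have "norm (c m - c n) \<le> M * (\<Sum>i<N. norm (c (m + i)))" using V by simp
  moreover have "norm (c (m + 0)) \<le> (\<Sum>i<N. norm (c (m + i)))"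
    using N by (intro member_le_sum) auto
  moreover have "norm (c n) \<le> norm (c m) + norm (c m - c n)"
    by (metis norm_minus_commute norm_triangle_sub)
  ultimately show ?thesis by (simp add: algebra_simps)
qed

text \<open>Every starting point \<open>l\<close> in \<open>[p, q)\<close> has \<open>n\<close>
  within its block, so \<open>c n\<close> is compared with each window and the estimates are added.
  Every shift by \<open>i < N\<close> stays inside \<open>[p, q + N)\<close>, whence the factor
  \<open>N\<close>.\<close>

lemma block_variation_average:
  assumes V: "block_variation c N M" and "1 \<le> p" "p \<le> q" "q \<le> n + 1" "n \<le> 2 * p + 1"
  shows "real (q - p) * norm (c n) \<le> (M + 1) * N * (\<Sum>l=p..<q+N. norm (c l))"
proof -
  have M: "M > 0" using V by (simp add: block_variation_def)
  have "real (q - p) * norm (c n) = (\<Sum>l=p..<q. norm (c n))" by simp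
  also have "\<dots> \<le> (\<Sum>l=p..<q. (M + 1) * (\<Sum>i<N. norm (c (l + i))))"
    using assms by (intro sum_mono block_variation_le) auto
  also have "\<dots> = (M + 1) * (\<Sum>i<N. \<Sum>l=p..<q. norm (c (l + i)))"
    by (subst sum.swap) (simp add: sum_distrib_left)
  also have "\<dots> \<le> (M + 1) * (\<Sum>i<N. \<Sum>l=p..<q+N. norm (c l))"
  proof (intro mult_left_mono sum_mono)
    fix i assume "i \<in> {..<N}"
    have "(\<Sum>l=p..<q. norm (c (l + i))) = (\<Sum>l=p+i..<q+i. norm (c l))"
      by (simp add: sum.shift_bounds_nat_ivl)
    also have "\<dots> \<le> (\<Sum>l=p..<q+N. norm (c l))"
      using \<open>i \<in> {..<N}\<close> by (intro sum_mono2) auto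
    finally show "(\<Sum>l=p..<q. norm (c (l + i))) \<le> (\<Sum>l=p..<q+N. norm (c l))" .
  qed (use M in auto)
  finally show ?thesis by (simp add: mult.assoc)
qed

text \<open>Bounded sums alone do not bound \<open>k\<close> times the \<open>k\<close>-th term;
  block variation does, by comparing that term with an average over about half of the preceding
  indices.\<close>

lemma block_variation_index_mult_le:
  assumes V: "block_variation c N M" and m: "m \<ge> 1" and k: "2 * m \<le> k"
    and R: "\<And>t. (\<Sum>l=m..<t. norm (c l)) \<le> R"
  shows "real k * norm (c k) \<le> 2 * (M + 1) * N * R"
proof -
  have M: "M > 0" using V by (simp add: block_variation_def)
  \<comment> \<open>This leaves at least \<open>k / 2\<close> starting points up to
    \<open>k\<close>, none of them below \<open>m\<close>, and keeps
    \<open>k \<le> 2 * p + 1\<close>.\<close>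
  define p where "p = (k + 1) div 2"
  have "real (k + 1 - p) * norm (c k) \<le> (M + 1) * N * (\<Sum>l=p..<k+1+N. norm (c l))"
    using m k by (intro block_variation_average[OF V]) (auto simp: p_def)
  also have "\<dots> \<le> (M + 1) * N * R"
  proof (intro mult_left_mono order_trans[OF _ R[of "k+1+N"]] sum_mono2)
    show "{p..<k + 1 + N} \<subseteq> {m..<k + 1 + N}" using k by (auto simp: p_def)
  qed (use M in auto)
  finally have "real (k + 1 - p) * norm (c k) \<le> (M + 1) * N * R" .
  moreover have "real k / 2 * norm (c k) \<le> real (k + 1 - p) * norm (c k)"
    by (intro mult_right_mono) (auto simp: p_def)
  ultimately have "real k / 2 * norm (c k) \<le> (M + 1) * N * R" by linarith
  then show ?thesis by (simp add: algebra_simps)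
qed

text \<open>All indices that occur are at least 1, so by the cone condition every weighted real part
  is nonnegative and those far from the centre may be dropped. Within distance \<open>k / 2\<close>
  the weights are at least 1/2, and averaging bounds the centre. The threshold \<open>2 * N\<close>
  keeps the overhang of the windows within that distance.\<close>

lemma GBV_fejer_mean_ge:
  fixes d :: "int \<Rightarrow> complex"
  assumes "GBV (\<lambda>n. d (int n))"
  shows "\<exists>C>0. \<exists>K. \<forall>n k. K \<le> k \<and> 1 \<le> k \<and> k \<le> n \<longrightarrow>
    real k * norm (d (int (n + k))) \<le> C * norm (fejer_mean d (int (n + k)) k)"
proof -
  let ?c = "\<lambda>n. d (int n)"
  obtain N M where V: "block_variation ?c N M" using GBV_imp_block_variation[OF assms] by blast
  then have M: "M > 0" "N \<ge> 1" by (auto simp: block_variation_def)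
  obtain \<kappa> where \<kappa>: "\<kappa> > 0" "\<And>n. n \<ge> 1 \<Longrightarrow> \<kappa> * norm (?c n) \<le> Re (?c n)"
    using GBV_cone[OF assms] by blast
  \<comment> \<open>One factor 2 is for the weight 1/2, the other for having only
    \<open>k / 2\<close> starting points; \<open>1 / \<kappa>\<close> is the cost of passing to real
    parts.\<close>
  define C where "C = 4 * (M + 1) * N / \<kappa>"
  have "real k * norm (?c (n + k)) \<le> C * norm (fejer_mean d (int (n + k)) k)"
    if k: "2 * N \<le> k" "1 \<le> k" "k \<le> n" for n k
  proof -
    define p where "p = n + (k + 1) div 2"
    define W where "W j = (real k - \<bar>of_int j\<bar>) / real k * Re (d (int (n + k) + j))" for j
    have nonneg: "0 \<le> W j" if "j \<in> {- int k..int k}" for j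
    proof -
      have "int (n + k) + j = int (nat (int (n + k) + j))" "nat (int (n + k) + j) \<ge> 1"
        using that k by auto
      then have "0 \<le> Re (d (int (n + k) + j))"
        using \<kappa>(2)[of "nat (int (n + k) + j)"] \<kappa>(1)
        by (metis mult_nonneg_nonneg norm_ge_zero order_less_imp_le order_trans)
      moreover have "\<bar>of_int j\<bar> \<le> real k" using that by (simp add: abs_le_iff)
      ultimately show ?thesis by (simp add: W_def)
    qed
    have "(\<Sum>l=p..<n+k+1+N. \<kappa> / 2 * norm (?c l)) \<le> (\<Sum>l=p..<n+k+1+N. W (int l - int (n + k)))"
    proof (rule sum_mono)
      fix l assume l: "l \<in> {p..<n+k+1+N}"
      have "2 * n + k \<le> 2 * l" "l \<le> n + k + N" using l by (auto simp: p_def)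
      then have "2 * \<bar>int l - int (n + k)\<bar> \<le> int k" using k by (auto simp: abs_if)
      then have "2 * \<bar>of_int (int l - int (n + k))\<bar> \<le> real k" by linarith
      then have w1: "1 / 2 \<le> (real k - \<bar>of_int (int l - int (n + k))\<bar>) / real k"
        using k by (simp add: field_simps)
      have w2: "\<kappa> * norm (?c l) \<le> Re (?c l)" using l k by (intro \<kappa>) (auto simp: p_def)
      have "1 / 2 * (\<kappa> * norm (?c l)) \<le> W (int l - int (n + k))"
        unfolding W_def
      proof (rule mult_mono)
        show "0 \<le> (real k - \<bar>of_int (int l - int (n + k))\<bar>) / real k"
          by (rule order_trans[OF _ w1]) simp
        show "0 \<le> \<kappa> * norm (?c l)" using \<kappa>(1) by simp
        show "\<kappa> * norm (?c l) \<le> Re (d (int (n + k) + (int l - int (n + k))))"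
          using w2 by simp
      qed (rule w1)
      then show "\<kappa> / 2 * norm (?c l) \<le> W (int l - int (n + k))" by simp
    qed
    also have "\<dots> = (\<Sum>j\<in>(\<lambda>l. int l - int (n + k)) ` {p..<n+k+1+N}. W j)"
      by (subst sum.reindex) (auto simp: inj_on_def)
    also have "\<dots> \<le> (\<Sum>j = - int k..int k. W j)"
      using k by (intro sum_mono2 nonneg) (auto simp: p_def)
    also have "\<dots> = Re (fejer_mean d (int (n + k)) k)"
      by (simp add: fejer_mean_eq W_def)
    also have "\<dots> \<le> norm (fejer_mean d (int (n + k)) k)" by (rule complex_Re_le_cmod)
    finally have 1: "\<kappa> / 2 * (\<Sum>l=p..<n+k+1+N. norm (?c l)) \<le> norm (fejer_mean d (int (n + k)) k)"
      by (simp only: sum_distrib_left)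
    have "real k / 2 * norm (?c (n + k)) \<le> real (n + k + 1 - p) * norm (?c (n + k))"
      using k by (intro mult_right_mono) (auto simp: p_def)
    also have "\<dots> \<le> (M + 1) * N * (\<Sum>l=p..<n+k+1+N. norm (?c l))"
      using k by (intro block_variation_average[OF V]) (auto simp: p_def)
    also have "\<dots> \<le> (M + 1) * N * (2 / \<kappa> * norm (fejer_mean d (int (n + k)) k))"
      using 1 \<kappa>(1) M by (intro mult_left_mono) (auto simp: field_simps)
    finally show ?thesis by (simp add: C_def field_simps)
  qed
  moreover have "C > 0" using M \<kappa> by (simp add: C_def)
  ultimately show ?thesis by blast
qed

text \<open>Removes the threshold on \<open>k\<close>: for small \<open>k\<close> the mean with
  \<open>N = 1\<close> is the coefficient itself and \<open>k \<le> K\<close>. The premise concerns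
  only blocks above \<open>n\<close>, as is available after subtraction of a polynomial of degree
  \<open>n\<close>.\<close>

lemma GBV_index_mult_le_fejer_bound:
  fixes d :: "int \<Rightarrow> complex"
  assumes "GBV (\<lambda>n. d (int n))"
  shows "\<exists>C>0. \<forall>n k E. 1 \<le> k \<longrightarrow> k \<le> n \<longrightarrow>
    (\<forall>m N. N \<ge> 1 \<longrightarrow> m \<ge> int (n + N) \<longrightarrow> norm (fejer_mean d m N) \<le> E) \<longrightarrow>
    real k * norm (d (int (n + k))) \<le> C * E"
proof -
  obtain C K where C: "C > 0" and *: "\<And>n k. K \<le> k \<Longrightarrow> 1 \<le> k \<Longrightarrow> k \<le> n \<Longrightarrow>
    real k * norm (d (int (n + k))) \<le> C * norm (fejer_mean d (int (n + k)) k)"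
    using GBV_fejer_mean_ge[OF assms] by blast
  have "real k * norm (d (int (n + k))) \<le> (C + K) * E"
    if k: "1 \<le> k" "k \<le> n" and E: "\<And>m N. N \<ge> 1 \<Longrightarrow> m \<ge> int (n + N) \<Longrightarrow> norm (fejer_mean d m N) \<le> E"
    for n k :: nat and E :: real
  proof -
    have E0: "E \<ge> 0" using E[of 1 "int (n + 1)"] norm_ge_zero order_trans by blast
    show ?thesis
    proof (cases "K \<le> k")
      case True
      have "real k * norm (d (int (n + k))) \<le> C * norm (fejer_mean d (int (n + k)) k)"
        using * True k by blast
      also have "\<dots> \<le> (C + K) * E" using C E[of k "int (n + k)"] k by (intro mult_mono) auto
      finally show ?thesis .
    next
      case False
      have "norm (d (int (n + k))) \<le> E"
        using E[of 1 "int (n + k)"] k by (simp add: fejer_mean_def)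
      then have "real k * norm (d (int (n + k))) \<le> (C + K) * E"
        using False C by (intro mult_mono) auto
      then show ?thesis .
    qed
  qed
  then show ?thesis using C by (intro exI[of _ "C + K"]) auto
qed

section \<open>Uniform bounds for sine sums\<close>

lemma norm_1_minus_cis_minus: "norm (1 - cis (- x)) = norm (1 - cis x)"
proof -
  have "1 - cis (- x) = - cis (- x) * (1 - cis x)" by (simp add: algebra_simps cis_mult)
  then show ?thesis by (simp only: norm_mult norm_minus_cancel norm_cis mult_1_left)
qed

lemma norm_cis_diff_le: "norm (cis (real k * x) - cis (- (real k * x))) \<le> 2 * real k * norm (1 - cis x)"
proof -
  have "cis (real k * x) - cis (- (real k * x)) = cis x ^ k - cis (- x) ^ k"
    by (simp only: Complex.DeMoivre mult_minus_right)
  also have "norm \<dots> \<le> real k * norm (cis x - cis (- x))"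
    by (intro norm_power_diff) auto
  also have "\<dots> \<le> real k * (norm (1 - cis (- x)) + norm (1 - cis x))"
    using norm_triangle_ineq4[of "1 - cis (- x)" "1 - cis x"] by (intro mult_left_mono) simp_all
  finally show ?thesis by (simp add: norm_1_minus_cis_minus)
qed

text \<open>In product form the geometric sum estimate needs no exception at multiples of
  \<open>2 * pi\<close>.\<close>

lemma norm_sum_cis_le: "norm (\<Sum>k=p..n. cis (real k * x)) * norm (1 - cis x) \<le> 2"
proof (cases "p \<le> n")
  case True
  then have "(\<Sum>k=p..n. cis (real k * x)) * (1 - cis x) = cis (real p * x) - cis (real (Suc n) * x)"
  proof (induction n rule: dec_induct)
    case base
    show ?case by (simp add: algebra_simps cis_mult)
  next
    case (step n)
    have "cis (real (Suc n) * x) * cis x = cis (real (Suc (Suc n)) * x)"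
      by (simp add: cis_mult algebra_simps)
    moreover have "(\<Sum>k=p..Suc n. cis (real k * x)) * (1 - cis x) =
        (\<Sum>k=p..n. cis (real k * x)) * (1 - cis x) + (cis (real (Suc n) * x) - cis (real (Suc n) * x) * cis x)"
      using step(1) by (simp add: ring_distribs)
    ultimately show ?case by (simp only: step(3)) simp
  qed
  then show ?thesis
    using norm_triangle_ineq4[of "cis (real p * x)" "cis (real (Suc n) * x)"]
    by (simp flip: norm_mult)
qed simp

text \<open>With \<open>d = norm (1 - cis x)\<close>, at most \<open>1 / d\<close> initial terms of
  size at most \<open>2 * d * \<epsilon>\<close> contribute \<open>2 * \<epsilon>\<close>. In the
  rest, blocks of sines are at most \<open>4 / d\<close>, which is at most 4 times the first index
  \<open>r\<close>; summation by parts then gives \<open>(4 + 4 * A) * \<epsilon>\<close>.\<close>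

lemma sine_sum_bound:
  fixes c :: "nat \<Rightarrow> complex"
  assumes p: "p \<ge> 1" and \<epsilon>: "\<epsilon> \<ge> 0" and A: "A \<ge> 0"
    and small: "\<And>k. p \<le> k \<Longrightarrow> k \<le> n \<Longrightarrow> real k * norm (c k) \<le> \<epsilon>"
    and variation: "\<And>K. p \<le> K \<Longrightarrow> K \<le> n \<Longrightarrow>
      real K * (\<Sum>k=K..<n. norm (c k - c (Suc k))) \<le> A * \<epsilon>"
  shows "norm (\<Sum>k=p..n. c k * (cis (real k * x) - cis (- (real k * x)))) \<le> (6 + 4 * A) * \<epsilon>"
proof (cases "p \<le> n \<and> norm (1 - cis x) > 0")
  case False
  have "(\<Sum>k=p..n. c k * (cis (real k * x) - cis (- (real k * x)))) = 0"
  proof (cases "p \<le> n")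
    case True
    with False have "norm (1 - cis x) = 0" by auto
    then have "cis (real k * x) - cis (- (real k * x)) = 0" for k
      using norm_cis_diff_le[of k x] by simp
    then show ?thesis by simp
  qed simp
  then show ?thesis using \<epsilon> A by simp
next
  case True
  define d where "d = norm (1 - cis x)"
  have d: "d > 0" using True by (simp add: d_def)
  define S where "S k = cis (real k * x) - cis (- (real k * x))" for k
  have S1: "norm (S k) \<le> 2 * real k * d" for k
    unfolding S_def d_def by (rule norm_cis_diff_le)
  have S2: "norm (\<Sum>k=a..b. S k) \<le> 4 / d" for a b
  proof -
    have "norm (\<Sum>k=a..b. S k) * d \<le> (norm (\<Sum>k=a..b. cis (real k * x)) + norm (\<Sum>k=a..b. cis (real k * - x))) * d"
      unfolding S_def sum_subtractf using d norm_triangle_ineq4 by (intro mult_right_mono) auto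
    also have "\<dots> \<le> 4"
      using norm_sum_cis_le[of x a b] norm_sum_cis_le[of "- x" a b]
      by (simp add: d_def norm_1_minus_cis_minus distrib_right)
    finally show ?thesis using d by (simp add: pos_le_divide_eq)
  qed
  \<comment> \<open>Rounding up adds less than one index, which is absorbed because the sum starts
    at \<open>p \<ge> 1\<close>.\<close>
  define K where "K = nat \<lceil>1 / d\<rceil>"
  have "1 / d > 0" using d by simp
  then have "real K = of_int \<lceil>1 / d\<rceil>" by (simp add: K_def)
  with \<open>1 / d > 0\<close> have K: "1 / d \<le> real K" "real K < 1 / d + 1" "K \<ge> 1"
    using ceiling_correct[of "1 / d"] by (linarith, linarith, cases K, auto)
  \<comment> \<open>The cut is clipped to the range of summation, so either part may be
    empty.\<close>
  define r where "r = max p (min K (Suc n))"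
  have r: "p \<le> r" "r \<le> Suc n" using True by (auto simp: r_def)
  have split: "(\<Sum>k=p..n. c k * S k) = (\<Sum>k=p..<r. c k * S k) + (\<Sum>k=r..n. c k * S k)"
    using sum.atLeastLessThan_concat[OF r, of "\<lambda>k. c k * S k"]
    by (simp add: atLeastLessThanSuc_atLeastAtMost)
  have part1: "norm (\<Sum>k=p..<r. c k * S k) \<le> 2 * \<epsilon>"
  proof -
    have "norm (\<Sum>k=p..<r. c k * S k) \<le> (\<Sum>k=p..<r. 2 * d * \<epsilon>)"
    proof (intro order_trans[OF norm_sum] sum_mono)
      fix k assume k: "k \<in> {p..<r}"
      have "norm (c k * S k) \<le> norm (c k) * (2 * real k * d)"
        unfolding norm_mult by (intro mult_left_mono S1) auto
      also have "\<dots> = 2 * d * (real k * norm (c k))" by simp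
      also have "\<dots> \<le> 2 * d * \<epsilon>" using k r d by (intro mult_left_mono small) auto
      finally show "norm (c k * S k) \<le> 2 * d * \<epsilon>" .
    qed
    also have "\<dots> = real (r - p) * (2 * d * \<epsilon>)" by simp
    also have "\<dots> \<le> (1 / d) * (2 * d * \<epsilon>)"
    proof (intro mult_right_mono)
      show "real (r - p) \<le> 1 / d"
        using K p d by (auto simp: r_def max_def min_def of_nat_diff not_le) 
    qed (use d \<epsilon> in auto)
    finally show ?thesis using d by simp
  qed
  have part2: "norm (\<Sum>k=r..n. c k * S k) \<le> (4 + 4 * A) * \<epsilon>"
  proof (cases "r \<le> n")
    case False
    then show ?thesis using \<epsilon> A by simp
  next
    case rn: True
    then have "K \<le> r" by (auto simp: r_def max_def min_def split: if_splits)
    then have rd: "1 \<le> real r * d" using K(1) d by (simp add: divide_le_eq) (meson mult_right_mono of_nat_mono order.trans less_imp_le)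
    let ?V = "norm (c n) + (\<Sum>k=r..<n. norm (c k - c (Suc k)))"
    have "norm (\<Sum>k=r..n. c k * S k) \<le> norm (c n) * (4 / d) + (\<Sum>k=r..<n. norm (c k - c (Suc k)) * (4 / d))"
      unfolding sum_by_parts[OF rn]
      by (intro order_trans[OF norm_triangle_ineq] add_mono order_trans[OF norm_sum] sum_mono)
        (simp_all only: norm_mult mult_left_mono[OF S2 norm_ge_zero])
    also have "\<dots> = 4 / d * ?V" by (simp add: sum_distrib_right[symmetric] algebra_simps sum_distrib_left)
    also have "\<dots> \<le> 4 * real r * ?V"
      using rd d by (intro mult_right_mono add_nonneg_nonneg sum_nonneg) (auto simp: divide_le_eq)
    also have "\<dots> = 4 * (real r * norm (c n) + real r * (\<Sum>k=r..<n. norm (c k - c (Suc k))))"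
      by (simp add: algebra_simps)
    also have "\<dots> \<le> 4 * (\<epsilon> + A * \<epsilon>)"
    proof (intro mult_left_mono add_mono)
      have "real r * norm (c n) \<le> real n * norm (c n)" using rn by (intro mult_right_mono) auto
      also have "\<dots> \<le> \<epsilon>" using r rn by (intro small) auto
      finally show "real r * norm (c n) \<le> \<epsilon>" .
      show "real r * (\<Sum>k=r..<n. norm (c k - c (Suc k))) \<le> A * \<epsilon>"
        using r rn by (intro variation) auto
    qed simp
    finally show ?thesis by (simp add: algebra_simps)
  qed
  show ?thesis
    using norm_triangle_ineq[of "\<Sum>k=p..<r. c k * S k" "\<Sum>k=r..n. c k * S k"] part1 part2
    unfolding S_def[symmetric] split by (simp add: algebra_simps)
qed

text \<open>The variation from \<open>K\<close> on is summed over dyadic blocks: a block starting at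
  \<open>K\<close> costs \<open>M * N * \<epsilon> / K\<close>, and the geometric series doubles the
  constant.\<close>

lemma sine_tail_bound:
  assumes V: "block_variation c N M" and p: "p \<ge> 1" and \<epsilon>: "\<epsilon> \<ge> 0"
    and small: "\<And>k. p \<le> k \<Longrightarrow> real k * norm (c k) \<le> \<epsilon>"
  shows "norm (\<Sum>k=p..n. c k * (cis (real k * x) - cis (- (real k * x)))) \<le> (6 + 4 * (2 * M * N)) * \<epsilon>"
proof (rule sine_sum_bound[OF p \<epsilon>])
  have M: "M > 0" using V by (simp add: block_variation_def)
  then show "2 * M * N \<ge> 0" by simp
  have block: "real K * (\<Sum>k=K..2*K. norm (c k - c (Suc k))) \<le> M * N * \<epsilon>" if "p \<le> K" for K
  proof -
    have "real K * (\<Sum>k=K..2*K. norm (c k - c (Suc k))) \<le> real K * (M * (\<Sum>i<N. norm (c (K + i))))"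
      using V that p by (intro mult_left_mono) (auto simp: block_variation_def)
    also have "\<dots> = M * (\<Sum>i<N. real K * norm (c (K + i)))"
      by (simp add: sum_distrib_left mult_ac)
    also have "\<dots> \<le> M * (\<Sum>i<N. \<epsilon>)"
    proof (intro mult_left_mono sum_mono)
      fix i
      have "real K * norm (c (K + i)) \<le> real (K + i) * norm (c (K + i))"
        by (intro mult_right_mono) auto
      also have "\<dots> \<le> \<epsilon>" using that by (intro small) auto
      finally show "real K * norm (c (K + i)) \<le> \<epsilon>" .
    qed (use M in auto)
    finally show ?thesis by simp
  qed
  show "real K * (\<Sum>k=K..<n. norm (c k - c (Suc k))) \<le> 2 * M * N * \<epsilon>" if "p \<le> K" for K
    using that
  proof (induction "n - K" arbitrary: K rule: less_induct)
    case less
    let ?v = "\<lambda>k. norm (c k - c (Suc k))"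
    show ?case
    proof (cases "n \<le> 2 * K")
      case True
      then have "real K * (\<Sum>k=K..<n. ?v k) \<le> real K * (\<Sum>k=K..2*K. ?v k)"
        by (intro mult_left_mono sum_mono2) auto
      also have "\<dots> \<le> M * N * \<epsilon>" using block less by blast
      also have "\<dots> \<le> 2 * M * N * \<epsilon>" using M \<epsilon> by simp
      finally show ?thesis .
    next
      case False
      then have "(\<Sum>k=K..<n. ?v k) = (\<Sum>k=K..<2*K. ?v k) + (\<Sum>k=2*K..<n. ?v k)"
        by (intro sum.atLeastLessThan_concat[symmetric]) auto
      moreover have "real K * (\<Sum>k=K..<2*K. ?v k) \<le> M * N * \<epsilon>"
        by (rule order_trans[OF _ block[OF less(2)]]) (intro mult_left_mono sum_mono2, auto)
      \<comment> \<open>The induction hypothesis is scaled by \<open>2 * K\<close>, so with the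
        factor \<open>K\<close> the remainder costs only half of
        \<open>2 * M * N * \<epsilon>\<close>.\<close>
      moreover have "real (2 * K) * (\<Sum>k=2*K..<n. ?v k) \<le> 2 * M * N * \<epsilon>"
        using False less p by (intro less(1)) auto
      ultimately show ?thesis by (simp add: distrib_left)
    qed
  qed
qed (use small in auto)

text \<open>Smallness is known only up to index \<open>2 * n\<close>, and the windows of the
  variation condition must not run past it. Hence the last \<open>N\<close> terms are estimated
  singly, costing \<open>2 * N * \<epsilon>\<close>; for the others a single block of variation
  reaches the end.\<close>

lemma sine_block_bound:
  assumes V: "block_variation c N M" and \<epsilon>: "\<epsilon> \<ge> 0"
    and small: "\<And>k. 1 \<le> k \<Longrightarrow> k \<le> n \<Longrightarrow> real k * norm (c (n + k)) \<le> \<epsilon>"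
  shows "norm (\<Sum>k=1..n. c (n + k) * (cis (real k * x) - cis (- (real k * x)))) \<le> (6 + 4 * (M * N) + 2 * real N) * \<epsilon>"
proof -
  have M: "M > 0" using V by (simp add: block_variation_def)
  let ?t = "\<lambda>k. c (n + k) * (cis (real k * x) - cis (- (real k * x)))"
  have "(\<Sum>k=1..n. ?t k) = (\<Sum>k=1..n-N. ?t k) + (\<Sum>k=n-N+1..n. ?t k)"
    using sum.ub_add_nat[of 1 "n - N" ?t "n - (n - N)"] by (cases "n - N = 0") auto
  moreover have "norm (\<Sum>k=1..n-N. ?t k) \<le> (6 + 4 * (M * N)) * \<epsilon>"
  proof (rule sine_sum_bound[of 1 \<epsilon> "M * N" "n - N" "\<lambda>k. c (n + k)"])
    show "real k * norm (c (n + k)) \<le> \<epsilon>" if "1 \<le> k" "k \<le> n - N" for k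
      using that by (intro small) auto
    fix K assume K: "1 \<le> K" "K \<le> n - N"
    have "(\<Sum>k=K..<n-N. norm (c (n + k) - c (n + Suc k))) = (\<Sum>k=n+K..<n+(n-N). norm (c k - c (Suc k)))"
      using sum.shift_bounds_nat_ivl[of "\<lambda>k. norm (c k - c (Suc k))" K n "n - N"]
      by (simp add: add.commute)
    also have "\<dots> \<le> (\<Sum>k=n+K..2*(n+K). norm (c k - c (Suc k)))"
      by (intro sum_mono2) auto
    also have "\<dots> \<le> M * (\<Sum>i<N. norm (c (n + K + i)))"
      using K by (intro block_variationD[OF V]) auto
    finally have "real K * (\<Sum>k=K..<n-N. norm (c (n + k) - c (n + Suc k))) \<le> real K * (M * (\<Sum>i<N. norm (c (n + K + i))))"
      by (intro mult_left_mono) auto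
    also have "\<dots> = M * (\<Sum>i<N. real K * norm (c (n + (K + i))))"
      by (simp add: sum_distrib_left mult_ac add.assoc)
    also have "\<dots> \<le> M * (\<Sum>i<N. \<epsilon>)"
    proof (intro mult_left_mono sum_mono)
      fix i assume i: "i \<in> {..<N}"
      have "real K * norm (c (n + (K + i))) \<le> real (K + i) * norm (c (n + (K + i)))"
        by (intro mult_right_mono) auto
      also have "\<dots> \<le> \<epsilon>" using K i by (intro small) auto
      finally show "real K * norm (c (n + (K + i))) \<le> \<epsilon>" .
    qed (use M in auto)
    finally show "real K * (\<Sum>k=K..<n-N. norm (c (n + k) - c (n + Suc k))) \<le> M * N * \<epsilon>" by simp
  qed (use M \<epsilon> in auto)
  moreover have "norm (\<Sum>k=n-N+1..n. ?t k) \<le> 2 * N * \<epsilon>"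
  proof -
    have "norm (\<Sum>k=n-N+1..n. ?t k) \<le> (\<Sum>k=n-N+1..n. 2 * \<epsilon>)"
    proof (intro order_trans[OF norm_sum] sum_mono)
      fix k assume k: "k \<in> {n-N+1..n}"
      have "norm (cis (real k * x) - cis (- (real k * x))) \<le> 2"
        using norm_triangle_ineq4[of "cis (real k * x)" "cis (- (real k * x))"] by simp
      moreover have "norm (c (n + k)) \<le> real k * norm (c (n + k))"
        using k by (simp add: mult_le_cancel_right1)
      moreover have "real k * norm (c (n + k)) \<le> \<epsilon>" using k by (intro small) auto
      ultimately have "norm (?t k) \<le> \<epsilon> * 2"
        unfolding norm_mult using \<epsilon> by (intro mult_mono) auto
      then show "norm (?t k) \<le> 2 * \<epsilon>" by simp
    qed
    also have "\<dots> = real (n - (n - N)) * (2 * \<epsilon>)" by simp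
    also have "\<dots> \<le> real N * (2 * \<epsilon>)" using \<epsilon> by (intro mult_right_mono) auto
    finally show ?thesis by simp
  qed
  ultimately show ?thesis
    using norm_triangle_ineq[of "\<Sum>k=1..n-N. ?t k" "\<Sum>k=n-N+1..n. ?t k"] by (simp add: algebra_simps)
qed


subsection \<open>Convergence of the series\<close>

lemma trig_sum_periodic: "trig_sum c n (x + 2 * pi) = trig_sum c n x"
  by (simp only: trig_sum_cis cis_periodic)

lemma continuous_on_trig_sum: "continuous_on A (trig_sum c n)"
  unfolding trig_sum_cis[abs_def] by (intro continuous_intros)

lemma trig_sum_in_C2pi: "trig_sum c n \<in> C2pi"
  by (simp add: C2pi_def continuous_on_trig_sum trig_sum_periodic)

lemma C2pi_diff: "f \<in> C2pi \<Longrightarrow> g \<in> C2pi \<Longrightarrow> (\<lambda>x. f x - g x) \<in> C2pi"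
  by (auto simp: C2pi_def intro: continuous_intros)

lemma C2pi_bounded:
  assumes "f \<in> C2pi"
  shows "\<exists>B. \<forall>x. norm (f x) \<le> B"
proof -
  have per: "f (x + 2 * pi) = f x" for x using assms by (simp add: C2pi_def)
  have shift: "f (x + of_int k * (2 * pi)) = f x" for x k
  proof (induction k rule: int_induct[where k = 0])
    case (step1 i)
    have "f (x + of_int (i + 1) * (2 * pi)) = f ((x + of_int i * (2 * pi)) + 2 * pi)"
      by (simp add: algebra_simps)
    then show ?case using step1 per by simp
  next
    case (step2 i)
    have "f (x + of_int i * (2 * pi)) = f ((x + of_int (i - 1) * (2 * pi)) + 2 * pi)"
      by (simp add: algebra_simps)
    then show ?case using step2 per by simp
  qed simp
  have "compact (f ` {0..2 * pi})"
    using assms by (intro compact_continuous_image) (auto simp: C2pi_def intro: continuous_on_subset)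
  then have "bounded (f ` {0..2 * pi})" by (rule compact_imp_bounded)
  then obtain B where B: "\<And>x. x \<in> {0..2 * pi} \<Longrightarrow> norm (f x) \<le> B"
    unfolding bounded_iff by blast
  have "norm (f x) \<le> B" for x
  proof -
    define k where "k = \<lfloor>x / (2 * pi)\<rfloor>"
    have "of_int k \<le> x / (2 * pi)" "x / (2 * pi) < of_int k + 1" by (simp_all add: k_def)
    then have "of_int k * (2 * pi) \<le> x" "x < (of_int k + 1) * (2 * pi)"
      by (simp_all add: pos_le_divide_eq pos_divide_less_eq)
    then have "x + of_int (- k) * (2 * pi) \<in> {0..2 * pi}" by (simp add: algebra_simps)
    from B[OF this] show ?thesis by (simp only: shift)
  qed
  then show ?thesis by blast
qed

lemma norm_le_sup_norm:
  assumes "f \<in> C2pi"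
  shows "norm (f x) \<le> sup_norm f"
proof -
  obtain B where "\<And>x. norm (f x) \<le> B" using C2pi_bounded[OF assms] by blast
  then show ?thesis unfolding sup_norm_def by (intro cSUP_upper) (auto intro!: bdd_aboveI)
qed

lemma series_in_C2pi_limit:
  "series_in_C2pi c \<Longrightarrow> (\<lambda>n. trig_sum c n x) \<longlonglongrightarrow> trig_series c x"
  by (simp add: series_in_C2pi_def trig_series_def convergent_LIMSEQ_iff)

lemma trig_polys_subset_C2pi: "t \<in> trig_polys n \<Longrightarrow> t \<in> C2pi"
  by (auto simp: trig_polys_def trig_sum_in_C2pi)

lemma trig_polys_add:
  assumes "s \<in> trig_polys n" "t \<in> trig_polys n"
  shows "(\<lambda>x. s x + t x) \<in> trig_polys n"
proof -
  obtain c d where "s = trig_sum c n" "t = trig_sum d n" using assms by (auto simp: trig_polys_def)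
  then have "(\<lambda>x. s x + t x) = trig_sum (\<lambda>k. c k + d k) n"
    by (simp add: trig_sum_cis fun_eq_iff distrib_right sum.distrib)
  then show ?thesis by (simp add: trig_polys_def)
qed

lemma trig_polys_monomial:
  assumes "\<bar>m\<bar> \<le> int n"
  shows "(\<lambda>x. w * cis (of_int m * x)) \<in> trig_polys n"
proof -
  have "trig_sum (\<lambda>k. if k = m then w else 0) n x = w * cis (of_int m * x)" for x
  proof -
    have "trig_sum (\<lambda>k. if k = m then w else 0) n x =
        (\<Sum>k = - int n..int n. if k = m then w * cis (of_int k * x) else 0)"
      unfolding trig_sum_cis by (intro sum.cong) auto
    then show ?thesis using assms by (simp add: abs_le_iff)
  qed
  then have "(\<lambda>x. w * cis (of_int m * x)) = trig_sum (\<lambda>k. if k = m then w else 0) n"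
    by (simp add: fun_eq_iff)
  then show ?thesis by (simp add: trig_polys_def)
qed

lemma trig_polys_sum:
  assumes "finite A" "\<And>k. k \<in> A \<Longrightarrow> t k \<in> trig_polys n"
  shows "(\<lambda>x. \<Sum>k\<in>A. t k x) \<in> trig_polys n"
  using assms
proof (induction rule: finite_induct)
  case empty
  show ?case using trig_polys_monomial[of 0 n 0] by simp
qed (auto intro: trig_polys_add)

lemma best_approx_le:
  assumes f: "f \<in> C2pi" and t: "t \<in> trig_polys n" and B: "\<And>x. norm (f x - t x) \<le> B"
  shows "best_approx n f \<le> B"
proof -
  have "best_approx n f \<le> sup_norm (\<lambda>x. f x - t x)"
    unfolding best_approx_def
  proof (rule cINF_lower[OF _ t])
    show "bdd_below ((\<lambda>t. sup_norm (\<lambda>x. f x - t x)) ` trig_polys n)"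
    proof (rule bdd_belowI2)
      fix s assume "s \<in> trig_polys n"
      then have "(\<lambda>x. f x - s x) \<in> C2pi" by (intro C2pi_diff f trig_polys_subset_C2pi)
      from norm_le_sup_norm[OF this, of 0] show "0 \<le> sup_norm (\<lambda>x. f x - s x)"
        using norm_ge_zero order_trans by blast
    qed
  qed
  also have "\<dots> \<le> B" unfolding sup_norm_def by (intro cSUP_least B) auto
  finally show ?thesis .
qed

section \<open>Criterion for a continuous sum\<close>

lemma trig_term_decomp:
  "trig_term c k x = (c (int k) + c (- int k)) * cis (- (real k * x)) +
     c (int k) * (cis (real k * x) - cis (- (real k * x)))"
  by (simp add: trig_term_def algebra_simps)

lemma norm_sum_trig_term_le:
  "norm (\<Sum>k=p..n. trig_term c k x) \<le> (\<Sum>k=p..n. norm (c (int k) + c (- int k))) +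
     norm (\<Sum>k=p..n. c (int k) * (cis (real k * x) - cis (- (real k * x))))"
  unfolding trig_term_decomp sum.distrib
  by (intro order_trans[OF norm_triangle_ineq] add_mono order_trans[OF norm_sum] sum_mono order_refl)
    (simp add: norm_mult)

lemma trig_sum_split:
  assumes "m \<le> n"
  shows "trig_sum c n x = trig_sum c m x + (\<Sum>k=Suc m..n. trig_term c k x)"
  using assms by (induction n rule: dec_induct) (simp_all add: trig_sum_Suc)

lemma series_in_C2pi_imp_summable:
  assumes b: "GBV (\<lambda>n. c (int n) + c (- int n))"
    and conv: "convergent (\<lambda>n. trig_sum c n 0)"
  shows "summable (\<lambda>n. norm (c (int n) + c (- int n)))"
proof -
  let ?b = "\<lambda>n. c (int n) + c (- int n)"
  obtain \<kappa> where \<kappa>: "\<kappa> > 0" "\<And>n. n \<ge> 1 \<Longrightarrow> \<kappa> * norm (?b n) \<le> Re (?b n)"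
    using GBV_cone[OF b] by blast
  have sum0: "trig_sum c n 0 = c 0 + (\<Sum>k=1..n. ?b k)" for n
    by (simp add: trig_sum_conv_terms trig_term_def)
  obtain B where B: "\<And>n. norm (trig_sum c n 0) \<le> B"
    using convergent_imp_Bseq[OF conv] by (meson BseqE)
  have "(\<Sum>k<n. norm (?b (Suc k))) \<le> (B + norm (c 0)) / \<kappa>" for n
  proof -
    have "\<kappa> * (\<Sum>k<n. norm (?b (Suc k))) \<le> Re (\<Sum>k<n. ?b (Suc k))"
      using \<kappa>(2) by (simp add: sum_distrib_left sum_mono del: of_nat_Suc)
    also have "(\<Sum>k<n. ?b (Suc k)) = trig_sum c n 0 - c 0"
      unfolding sum0 by (simp add: sum.atLeast1_atMost_eq)
    also have "Re \<dots> \<le> norm (trig_sum c n 0 - c 0)" by (rule complex_Re_le_cmod)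
    also have "\<dots> \<le> B + norm (c 0)" using norm_triangle_ineq4 B add_mono order_trans by (metis add_le_cancel_right)
    finally show ?thesis using \<kappa>(1) by (simp add: pos_le_divide_eq mult.commute)
  qed
  then have "summable (\<lambda>k. norm (?b (Suc k)))" by (intro summableI_nonneg_bounded) auto
  then show ?thesis by (subst (asm) summable_Suc_iff)
qed

lemma series_in_C2pi_imp_index_mult_tendsto_0:
  assumes a: "GBV (\<lambda>n. c (int n))" and c: "series_in_C2pi c"
  shows "(\<lambda>n. of_nat n * c (int n)) \<longlonglongrightarrow> 0"
proof (rule LIMSEQ_I)
  fix e :: real assume e: "e > 0"
  have f: "continuous_on UNIV (trig_series c)" using c by (simp add: series_in_C2pi_def C2pi_def)
  obtain C K where C: "C > 0" and *: "\<And>n k. K \<le> k \<Longrightarrow> 1 \<le> k \<Longrightarrow> k \<le> n \<Longrightarrow>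
    real k * norm (c (int (n + k))) \<le> C * norm (fejer_mean c (int (n + k)) k)"
    using GBV_fejer_mean_ge[OF a] by blast
  have "e / (4 * C) > 0" using e C by simp
  from fejer_mean_tendsto_0[OF f trig_series_coeffs[OF series_in_C2pi_limit[OF c] f] this]
  obtain N0 where N0: "\<And>N m. N \<ge> N0 \<Longrightarrow> m \<ge> int N \<Longrightarrow> norm (fejer_mean c m N) \<le> e / (4 * C)"
    by blast
  show "\<exists>no. \<forall>n\<ge>no. norm (of_nat n * c (int n) - 0) < e"
  proof (rule exI[of _ "2 * (N0 + K + 1)"], intro allI impI)
    fix n assume n: "2 * (N0 + K + 1) \<le> n"
    \<comment> \<open>The block of radius \<open>k\<close> centred at \<open>n\<close> meets
      positive frequencies only. Rounding leaves \<open>n \<le> 3 * k\<close>, and the factor 3 is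
      absorbed by the 4 in \<open>e / (4 * C)\<close>.\<close>
    define k where "k = n div 2"
    have k: "K \<le> k" "1 \<le> k" "k \<le> n - k" "N0 \<le> k" "n \<le> 3 * k" "n - k + k = n"
      using n by (auto simp: k_def)
    have "real n * norm (c (int n)) \<le> 3 * (real k * norm (c (int n)))"
      using k mult_right_mono[of "real n" "3 * real k" "norm (c (int n))"] by simp
    also have "real k * norm (c (int n)) \<le> C * norm (fejer_mean c (int n) k)"
      using *[of k "n - k"] k by simp
    also have "\<dots> \<le> C * (e / (4 * C))" using C k by (intro mult_left_mono N0) auto
    also have "3 * (C * (e / (4 * C))) < e" using e C by simp
    finally show "norm (of_nat n * c (int n) - 0) < e" by (simp add: norm_mult)
  qed
qed

lemma series_in_C2pi_sufficient:
  assumes a: "GBV (\<lambda>n. c (int n))" and b: "summable (\<lambda>n. norm (c (int n) + c (- int n)))"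
    and lim: "(\<lambda>n. of_nat n * c (int n)) \<longlonglongrightarrow> 0"
  shows "series_in_C2pi c"
proof -
  obtain N M where V: "block_variation (\<lambda>n. c (int n)) N M" using GBV_imp_block_variation[OF a] by blast
  then have M: "M > 0" by (simp add: block_variation_def)
  define C where "C = 6 + 4 * (2 * M * N)"
  have C: "C > 0" using M by (simp add: C_def add_pos_nonneg)
  have "uniformly_Cauchy_on UNIV (trig_sum c)"
  proof (rule uniformly_Cauchy_onI')
    fix e :: real assume e: "e > 0"
    obtain N1 where N1: "\<And>m n. m \<ge> N1 \<Longrightarrow> norm (\<Sum>k=m..<n. norm (c (int k) + c (- int k))) < e / 2"
      using b e unfolding summable_Cauchy by (meson half_gt_zero)
    have "e / (2 * C) > 0" using e C by simp
    from LIMSEQ_D[OF lim this] obtain N2 where N2: "\<And>k. k \<ge> N2 \<Longrightarrow> norm (of_nat k * c (int k)) < e / (2 * C)"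
      by auto
    show "\<exists>P. \<forall>x\<in>UNIV. \<forall>m\<ge>P. \<forall>n>m. dist (trig_sum c m x) (trig_sum c n x) < e"
    proof (rule exI[of _ "max N1 N2"], intro ballI allI impI)
      fix x m n assume mn: "max N1 N2 \<le> m" "m < n"
      have "dist (trig_sum c m x) (trig_sum c n x) = norm (\<Sum>k=Suc m..n. trig_term c k x)"
        using trig_sum_split[of m n c x] mn by (simp add: dist_norm norm_minus_commute)
      also have "\<dots> \<le> (\<Sum>k=Suc m..n. norm (c (int k) + c (- int k))) +
          norm (\<Sum>k=Suc m..n. c (int k) * (cis (real k * x) - cis (- (real k * x))))"
        by (rule norm_sum_trig_term_le)
      also have "(\<Sum>k=Suc m..n. norm (c (int k) + c (- int k))) < e / 2"
        using N1[of "Suc m" "Suc n"] mn by (simp only: atLeastLessThanSuc_atLeastAtMost real_norm_def) simp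
      also have "norm (\<Sum>k=Suc m..n. c (int k) * (cis (real k * x) - cis (- (real k * x)))) \<le> C * (e / (2 * C))"
        unfolding C_def
      proof (rule sine_tail_bound[OF V])
        fix k assume "Suc m \<le> k"
        then show "real k * norm (c (int k)) \<le> e / (2 * (6 + 4 * (2 * M * N)))"
          using N2[of k] mn by (simp add: norm_mult C_def)
      qed (use e M in auto)
      also have "e / 2 + C * (e / (2 * C)) = e" using C by simp
      finally show "dist (trig_sum c m x) (trig_sum c n x) < e" by simp
    qed
  qed
  then have "uniformly_convergent_on UNIV (trig_sum c)"
    by (rule Cauchy_uniformly_convergent)
  then obtain l where l: "uniform_limit UNIV (trig_sum c) l sequentially"
    by (auto simp: uniformly_convergent_on_def)
  have lim: "(\<lambda>n. trig_sum c n x) \<longlonglongrightarrow> l x" for x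
    using tendsto_uniform_limitI[OF l] by simp
  then have eq: "trig_series c = l" by (simp add: trig_series_def limI fun_eq_iff)
  have "continuous_on UNIV l"
    by (rule uniform_limit_theorem[OF _ l]) (auto simp: continuous_on_trig_sum)
  moreover have "l (x + 2 * pi) = l x" for x
    using lim[of "x + 2 * pi"] lim[of x] by (simp add: trig_sum_periodic LIMSEQ_unique)
  ultimately show ?thesis
    using lim by (auto simp: series_in_C2pi_def eq C2pi_def convergent_def)
qed


subsection \<open>Best approximation\<close>

lemma cis_reflected_diff:
  "cis (real (n + k) * x) - cis (real (n - k) * x) =
     cis (real n * x) * (cis (real k * x) - cis (- (real k * x)))"
  "cis (- (real (n + k) * x)) - cis (- (real (n - k) * x)) =
     - (cis (- (real n * x)) * (cis (real k * x) - cis (- (real k * x))))"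
  if "k \<le> n"
  using that by (simp_all add: cis_mult of_nat_diff algebra_simps)

text \<open>The block of frequencies between \<open>n + 1\<close> and \<open>2n\<close> is reflected about \<open>n\<close> to frequencies
  below \<open>n\<close>; the error of this replacement is again a sine sum.\<close>
definition near_best :: "(int \<Rightarrow> complex) \<Rightarrow> nat \<Rightarrow> real \<Rightarrow> complex" where
  "near_best c n x = trig_sum c n x + (\<Sum>k=1..n. c (int (n + k)) * cis (real (n - k) * x) +
     c (- int (n + k)) * cis (- (real (n - k) * x)))"

lemma near_best_in_trig_polys: "near_best c n \<in> trig_polys n"
proof -
  have "(\<lambda>x. trig_sum c n x + (\<Sum>k=1..n. c (int (n + k)) * cis (of_int (int (n - k)) * x) +
     c (- int (n + k)) * cis (of_int (- int (n - k)) * x))) \<in> trig_polys n"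
    by (intro trig_polys_add trig_polys_sum trig_polys_monomial) (auto simp: trig_polys_def)
  then show ?thesis
    by (simp only: near_best_def[abs_def] of_int_of_nat_eq of_int_minus mult_minus_left)
qed

text \<open>The range up to \<open>2 * n\<close> is handled by reflection and the range up to
  \<open>4 * n + 1\<close> term by term. The sine tail starts only at \<open>4 * n + 2\<close>,
  twice the first index whose symmetric sums are bounded by \<open>R\<close>, since only from there
  does \<open>R\<close> control \<open>k\<close> times the \<open>k\<close>-th symmetric sum. The
  bound is uniform in \<open>K\<close>, ready for a limit.\<close>

lemma norm_trig_sum_minus_near_best_le:
  assumes a: "GBV (\<lambda>n. c (int n))" and b: "GBV (\<lambda>n. c (int n) + c (- int n))"
  shows "\<exists>C>0. \<forall>n\<ge>1. \<forall>J D R K x.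
    (\<forall>k\<in>{1..n}. real k * (norm (c (int (n + k))) + norm (c (- int (n + k)))) \<le> J) \<and>
    (\<forall>k\<ge>2 * n + 1. real k * norm (c (int k) - c (- int k)) \<le> D) \<and>
    (\<forall>t. (\<Sum>k=2 * n + 1..<t. norm (c (int k) + c (- int k))) \<le> R) \<and> K \<ge> 4 * n + 1 \<longrightarrow>
    norm (trig_sum c K x - near_best c n x) \<le> C * (J + D + R)"
proof -
  let ?a = "\<lambda>n. c (int n)" and ?b = "\<lambda>n. c (int n) + c (- int n)"
  obtain N M where V: "block_variation ?a N M" using GBV_imp_block_variation[OF a] by blast
  obtain N' M' where V': "block_variation ?b N' M'" using GBV_imp_block_variation[OF b] by blast
  have M: "M > 0" "M' > 0" using V V' by (auto simp: block_variation_def)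
  define C1 where "C1 = 6 + 4 * (M * N) + 2 * real N"
  define C2 where "C2 = 6 + 4 * (M' * N') + 2 * real N'"
  define C3 where "C3 = 6 + 4 * (2 * M * N)"
  define Q where "Q = (M' + 1) * N'"
  have pos: "C1 > 0" "C2 > 0" "C3 > 0" "Q \<ge> 0"
    using M by (simp_all add: C1_def C2_def C3_def Q_def add_pos_nonneg)
  define C where "C = 2 * C1 + C2 + 3 + C3 * (1 + Q)"
  have "norm (trig_sum c K x - near_best c n x) \<le> C * (J + D + R)"
    if n: "n \<ge> 1" and J: "\<And>k. k \<in> {1..n} \<Longrightarrow> real k * (norm (c (int (n + k))) + norm (c (- int (n + k)))) \<le> J"
      and D: "\<And>k. k \<ge> 2 * n + 1 \<Longrightarrow> real k * norm (c (int k) - c (- int k)) \<le> D"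
      and R: "\<And>t. (\<Sum>k=2 * n + 1..<t. norm (?b k)) \<le> R" and K: "K \<ge> 4 * n + 1"
    for n J D R K x
  proof -
    define S where "S k = cis (real k * x) - cis (- (real k * x))" for k
    have J0: "J \<ge> 0" using order_trans[OF _ J[of 1]] n by simp
    have D0: "D \<ge> 0" using order_trans[OF _ D[of "2 * n + 1"]] by simp
    have R0: "R \<ge> 0" using R[of 0] by simp
    have Rc: "(\<Sum>k=p..t. norm (?b k)) \<le> R" if "p \<ge> 2 * n + 1" for p t
      by (rule order_trans[OF _ R[of "Suc t"]]) (intro sum_mono2, use that in auto)
    define A where "A = (\<Sum>k=1..n. ?a (n + k) * S k)"
    define B where "B = (\<Sum>k=1..n. ?b (n + k) * S k)"
    have "norm A \<le> C1 * J" unfolding A_def C1_def S_def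
    proof (rule sine_block_bound[OF V J0])
      fix k assume "1 \<le> k" "k \<le> n"
      then show "real k * norm (?a (n + k)) \<le> J"
        by (intro order_trans[OF _ J[of k]] mult_left_mono) auto
    qed
    moreover have "norm B \<le> C2 * J" unfolding B_def C2_def S_def
    proof (rule sine_block_bound[OF V' J0])
      fix k assume "1 \<le> k" "k \<le> n"
      then show "real k * norm (?b (n + k)) \<le> J"
        by (intro order_trans[OF _ J[of k]] mult_left_mono norm_triangle_ineq) auto
    qed
    ultimately have AB: "norm A \<le> C1 * J" "norm B \<le> C2 * J" by blast+
    define B1 where "B1 = (\<Sum>k=Suc n..2 * n. trig_term c k x) -
       (\<Sum>k=1..n. c (int (n + k)) * cis (real (n - k) * x) + c (- int (n + k)) * cis (- (real (n - k) * x)))"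
    \<comment> \<open>Writing the coefficient at \<open>-(n + k)\<close> as
      \<open>?b (n + k) - ?a (n + k)\<close> leaves two sine sums only, each over a sequence of
      bounded block variation.\<close>
    have B1_eq: "B1 = cis (real n * x) * A - cis (- (real n * x)) * (B - A)"
    proof -
      have "(\<Sum>k=Suc n..2 * n. trig_term c k x) = (\<Sum>k=1..n. trig_term c (n + k) x)"
        using sum.shift_bounds_cl_nat_ivl[of "\<lambda>k. trig_term c k x" 1 n n] by (simp add: add.commute mult_2)
      then have "B1 = (\<Sum>k=1..n. trig_term c (n + k) x -
         (c (int (n + k)) * cis (real (n - k) * x) + c (- int (n + k)) * cis (- (real (n - k) * x))))"
        by (simp only: B1_def sum_subtractf)
      also have "\<dots> = (\<Sum>k=1..n. cis (real n * x) * (?a (n + k) * S k) - cis (- (real n * x)) * (?b (n + k) * S k - ?a (n + k) * S k))"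
      proof (rule sum.cong[OF refl])
        fix k assume "k \<in> {1..n}"
        then have k: "k \<le> n" by simp
        have "trig_term c (n + k) x -
         (c (int (n + k)) * cis (real (n - k) * x) + c (- int (n + k)) * cis (- (real (n - k) * x))) =
          c (int (n + k)) * (cis (real (n + k) * x) - cis (real (n - k) * x)) +
          c (- int (n + k)) * (cis (- (real (n + k) * x)) - cis (- (real (n - k) * x)))"
          by (simp only: trig_term_def) (simp only: ring_distribs add_diff_add)
        also have "\<dots> = cis (real n * x) * (?a (n + k) * S k) - cis (- (real n * x)) * (?b (n + k) * S k - ?a (n + k) * S k)"
          unfolding cis_reflected_diff[OF k] S_def[symmetric] by (simp add: algebra_simps)
        finally show "trig_term c (n + k) x -
         (c (int (n + k)) * cis (real (n - k) * x) + c (- int (n + k)) * cis (- (real (n - k) * x))) = \<dots>" .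
      qed
      also have "\<dots> = cis (real n * x) * A - cis (- (real n * x)) * (B - A)"
        by (simp only: A_def B_def sum_subtractf sum_distrib_left[symmetric])
      finally show ?thesis .
    qed
    have "norm B1 \<le> norm (cis (real n * x) * A) + norm (cis (- (real n * x)) * (B - A))"
      unfolding B1_eq by (rule norm_triangle_ineq4)
    also have "\<dots> \<le> norm A + (norm B + norm A)"
      by (simp only: norm_mult norm_cis mult_1_left add_left_mono norm_triangle_ineq4)
    finally have B1: "norm B1 \<le> (2 * C1 + C2) * J"
      using AB by (simp add: algebra_simps)
    define B2 where "B2 = (\<Sum>k=Suc (2 * n)..4 * n + 1. trig_term c k x)"
    \<comment> \<open>The coefficient is half of its even plus odd part; beyond \<open>2 * n\<close>
      these parts are what \<open>R\<close> and \<open>D\<close> control.\<close>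
    have twice: "2 * norm (?a k) \<le> norm (?b k) + norm (c (int k) - c (- int k))" for k
    proof -
      have "2 * norm (?a k) = norm (?b k + (c (int k) - c (- int k)))" by (simp flip: norm_mult)
      then show ?thesis by (simp only: norm_triangle_ineq)
    qed
    \<comment> \<open>The range has exactly \<open>2 * n + 1\<close> indices, so the contributions
      \<open>D / (2 * n + 1)\<close> add up to \<open>D\<close>.\<close>
    have "norm B2 \<le> (\<Sum>k=Suc (2 * n)..4 * n + 1. 2 * norm (?b k) + D / real (2 * n + 1))"
      unfolding B2_def
    proof (intro order_trans[OF norm_sum] sum_mono)
      fix k assume k: "k \<in> {Suc (2 * n)..4 * n + 1}"
      have "norm (trig_term c k x) \<le> norm (?b k) + norm (?a k) * norm (cis (real k * x) - cis (- (real k * x)))"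
        unfolding trig_term_decomp by (rule order_trans[OF norm_triangle_ineq]) (simp add: norm_mult)
      also have "\<dots> \<le> norm (?b k) + norm (?a k) * 2"
        using norm_triangle_ineq4[of "cis (real k * x)" "cis (- (real k * x))"]
        by (intro add_left_mono mult_left_mono) auto
      also have "\<dots> \<le> 2 * norm (?b k) + norm (c (int k) - c (- int k))" using twice[of k] by simp
      also have "norm (c (int k) - c (- int k)) \<le> D / real (2 * n + 1)"
      proof -
        have "real (2 * n + 1) * norm (c (int k) - c (- int k)) \<le> real k * norm (c (int k) - c (- int k))"
          using k by (intro mult_right_mono) auto
        also have "\<dots> \<le> D" using k by (intro D) auto
        finally show ?thesis by (simp add: pos_le_divide_eq mult.commute)
      qed
      finally show "norm (trig_term c k x) \<le> 2 * norm (?b k) + D / real (2 * n + 1)" by simp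
    qed
    also have "\<dots> = 2 * (\<Sum>k=Suc (2 * n)..4 * n + 1. norm (?b k)) + D"
    proof -
      have "real (card {Suc (2 * n)..4 * n + 1}) * (D / real (2 * n + 1)) = D" by simp
      then show ?thesis by (simp only: sum.distrib sum_distrib_left sum_constant)
    qed
    also have "\<dots> \<le> 2 * R + D" using Rc[of "Suc (2 * n)" "4 * n + 1"] by simp
    finally have B2: "norm B2 \<le> 2 * R + D" .
    define B3 where "B3 = (\<Sum>k=Suc (4 * n + 1)..K. trig_term c k x)"
    have "norm (\<Sum>k=Suc (4 * n + 1)..K. ?a k * (cis (real k * x) - cis (- (real k * x)))) \<le> C3 * (D + Q * R)"
      unfolding C3_def
    proof (rule sine_tail_bound[OF V])
      fix k assume k: "Suc (4 * n + 1) \<le> k"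
      have "real k * norm (?b k) \<le> 2 * (M' + 1) * N' * R"
        by (rule block_variation_index_mult_le[OF V' _ _ R]) (use k in auto)
      moreover have "real k * norm (c (int k) - c (- int k)) \<le> D" using k by (intro D) auto
      moreover have "2 * (real k * norm (?a k)) \<le> real k * norm (?b k) + real k * norm (c (int k) - c (- int k))"
        using mult_left_mono[OF twice[of k], of "real k"] by (simp add: distrib_left)
      ultimately have "2 * (real k * norm (?a k)) \<le> D + 2 * (Q * R)" 
        unfolding Q_def by (simp only: mult.assoc)
      then show "real k * norm (?a k) \<le> D + Q * R" using D0 by linarith
    qed (use D0 R0 pos in auto)
    then have B3: "norm B3 \<le> R + C3 * (D + Q * R)"
      using norm_sum_trig_term_le[of c x "Suc (4 * n + 1)" K] Rc[of "Suc (4 * n + 1)" K]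
      unfolding B3_def by linarith
    have "trig_sum c K x - near_best c n x = B1 + B2 + B3"
      using trig_sum_split[of n "2 * n" c x] trig_sum_split[of "2 * n" "4 * n + 1" c x]
        trig_sum_split[OF K, of c x]
      unfolding B1_def B2_def B3_def near_best_def by simp
    then have "norm (trig_sum c K x - near_best c n x) \<le> norm B1 + norm B2 + norm B3"
      using norm_triangle_ineq[of "B1 + B2" B3] norm_triangle_ineq[of B1 B2] by simp
    also have "\<dots> \<le> (2 * C1 + C2) * J + (2 * R + D) + (R + C3 * (D + Q * R))"
      using B1 B2 B3 by simp
    also have "\<dots> \<le> C * (J + D + R)"
    proof -
      have "0 \<le> (3 + C3 * (1 + Q)) * J + (2 * C1 + C2 + 2 + C3 * Q) * D + (2 * C1 + C2 + C3) * R"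
        using pos J0 D0 R0 by (intro add_nonneg_nonneg mult_nonneg_nonneg) simp_all
      then show ?thesis unfolding C_def by (simp add: algebra_simps)
    qed
    finally show ?thesis .
  qed
  moreover have "C > 0" using pos by (simp add: C_def add_pos_nonneg)
  ultimately show ?thesis by blast
qed

section \<open>Lower bound for the best approximation\<close>

lemma fejer_mean_even_part:
  "fejer_mean (\<lambda>k. c k + c (- k)) m N = fejer_mean c m N + fejer_mean c (- m) N"
proof -
  have "(\<Sum>j<N. \<Sum>l<N. c (- (m + int j - int l))) = (\<Sum>j<N. \<Sum>l<N. c (- m + int j - int l))"
    by (subst sum.swap) (simp add: algebra_simps)
  then show ?thesis by (simp add: fejer_mean_def sum.distrib add_divide_distrib)
qed

text \<open>Truncated weights give means of different orders and the partial sum one common range,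
  so that they can be combined termwise.\<close>

lemma fejer_mean_eq_sum:
  assumes "N \<ge> 1" "N \<le> K"
  shows "fejer_mean c 0 N = (\<Sum>k = - int K..int K. of_real (max 0 (1 - \<bar>of_int k\<bar> / real N)) * c k)"
proof -
  have "fejer_mean c 0 N = (\<Sum>k = - int N..int N. of_real (max 0 (1 - \<bar>of_int k\<bar> / real N)) * c k)"
    unfolding fejer_mean_eq
  proof (rule sum.cong[OF refl])
    fix k assume "k \<in> {- int N..int N}"
    then have "\<bar>of_int k\<bar> \<le> real N" by (simp add: abs_le_iff)
    then have "(real N - \<bar>of_int k\<bar>) / real N = max 0 (1 - \<bar>of_int k\<bar> / real N)"
      using assms by (simp add: max_def diff_divide_distrib divide_le_eq)
    then show "of_real ((real N - \<bar>of_int k\<bar>) / real N) * c (0 + k) =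
        of_real (max 0 (1 - \<bar>of_int k\<bar> / real N)) * c k" by simp
  qed
  also have "\<dots> = (\<Sum>k = - int K..int K. of_real (max 0 (1 - \<bar>of_int k\<bar> / real N)) * c k)"
  proof (rule sum.mono_neutral_left)
    show "\<forall>k\<in>{- int K..int K} - {- int N..int N}. of_real (max 0 (1 - \<bar>of_int k\<bar> / real N)) * c k = 0"
    proof
      fix k assume "k \<in> {- int K..int K} - {- int N..int N}"
      then have "int N \<le> \<bar>k\<bar>" by auto
      then have "real N \<le> \<bar>of_int k\<bar>" by linarith
      then have "max 0 (1 - \<bar>of_int k\<bar> / real N) = 0" using assms by (simp add: max_def le_divide_eq)
      then show "of_real (max 0 (1 - \<bar>of_int k\<bar> / real N)) * c k = 0" by simp
    qed
  qed (use assms in auto)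
  finally show ?thesis .
qed

text \<open>The estimates are proved for the distance \<open>B\<close> to an arbitrary polynomial
  \<open>t\<close>, and the infimum is taken last. The remainder \<open>f - t\<close> has the
  coefficients \<open>e\<close>, which agree with \<open>c\<close> beyond \<open>n\<close>.\<close>

lemma best_approx_ge:
  assumes a: "GBV (\<lambda>n. c (int n))" and b: "GBV (\<lambda>n. c (int n) + c (- int n))"
    and c: "series_in_C2pi c"
  shows "\<exists>C>0. \<forall>n\<ge>1.
    (\<forall>k\<in>{1..n}. real k * (norm (c (int (n + k))) + norm (c (- int (n + k)))) \<le> C * best_approx n (trig_series c)) \<and>
    (\<forall>k\<ge>2 * n + 1. real k * norm (c (int k) - c (- int k)) \<le> C * best_approx n (trig_series c)) \<and>
    (\<forall>t. (\<Sum>k=2 * n + 1..<t. norm (c (int k) + c (- int k))) \<le> C * best_approx n (trig_series c))"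
proof -
  let ?a = "\<lambda>n. c (int n)" and ?b = "\<lambda>n. c (int n) + c (- int n)"
  define f where "f = trig_series c"
  have f: "f \<in> C2pi" using c by (simp add: f_def series_in_C2pi_def)
  obtain \<kappa> where \<kappa>: "\<kappa> > 0" "\<And>n. n \<ge> 1 \<Longrightarrow> \<kappa> * norm (?b n) \<le> Re (?b n)"
    using GBV_cone[OF b] by blast
  obtain C1 where C1: "C1 > 0" and C1': "\<forall>n k E. 1 \<le> k \<longrightarrow> k \<le> n \<longrightarrow>
    (\<forall>m N. N \<ge> 1 \<longrightarrow> m \<ge> int (n + N) \<longrightarrow> norm (fejer_mean c m N) \<le> E) \<longrightarrow>
    real k * norm (?a (n + k)) \<le> C1 * E"
    using GBV_index_mult_le_fejer_bound[OF a] by blast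
  obtain C2 where C2: "C2 > 0" and C2': "\<forall>n k E. 1 \<le> k \<longrightarrow> k \<le> n \<longrightarrow>
    (\<forall>m N. N \<ge> 1 \<longrightarrow> m \<ge> int (n + N) \<longrightarrow> norm (fejer_mean (\<lambda>k. c k + c (- k)) m N) \<le> E) \<longrightarrow>
    real k * norm (?b (n + k)) \<le> C2 * E"
    using GBV_index_mult_le_fejer_bound[of "\<lambda>k. c k + c (- k)"] b by blast
  \<comment> \<open>The coefficient at a negative index costs one bound for \<open>?a\<close> and
    one for \<open>?b\<close>, and means of \<open>?b\<close> are bounded by \<open>2 * B\<close>.
    In \<open>C\<close>, the 3 comes from halving an index and the 4 from the de la Vallee-Poussin
    estimate at 0.\<close>
  define C3 where "C3 = 2 * C1 + 2 * C2"
  define C where "C = 3 * C3 + 4 / \<kappa>"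
  have pos: "C3 > 0" "C > 0" using C1 C2 \<kappa> by (simp_all add: C3_def C_def add_pos_pos)
  have main: "(\<forall>k\<in>{1..n}. real k * (norm (c (int (n + k))) + norm (c (- int (n + k)))) \<le> C * B) \<and>
    (\<forall>k\<ge>2 * n + 1. real k * norm (c (int k) - c (- int k)) \<le> C * B) \<and>
    (\<forall>t. (\<Sum>k=2 * n + 1..<t. norm (?b k)) \<le> C * B)"
    if n: "n \<ge> 1" and t: "t \<in> trig_polys n" and B: "B = sup_norm (\<lambda>x. f x - t x)" for n t B
  proof -
    obtain d where d: "t = trig_sum d n" using t by (auto simp: trig_polys_def)
    define e where "e k = c k - (if \<bar>k\<bar> \<le> int n then d k else 0)" for k
    define g where "g x = f x - t x" for x
    have g: "g \<in> C2pi" unfolding g_def by (intro C2pi_diff f trig_polys_subset_C2pi[OF t])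
    have gB: "norm (g x) \<le> B" for x using norm_le_sup_norm[OF g] by (simp add: B g_def[abs_def])
    have B0: "B \<ge> 0" using gB[of 0] norm_ge_zero order_trans by blast
    have trig_e: "trig_sum e K x = trig_sum c K x - t x" if "K \<ge> n" for K x
    proof -
      have "(\<Sum>k = - int K..int K. (if \<bar>k\<bar> \<le> int n then d k else 0) * cis (of_int k * x)) =
          (\<Sum>k = - int n..int n. d k * cis (of_int k * x))"
        using that by (intro sum.mono_neutral_cong_right) auto
      then show ?thesis by (simp add: d trig_sum_cis e_def left_diff_distrib sum_subtractf)
    qed
    have lim: "(\<lambda>K. trig_sum e K x) \<longlonglongrightarrow> g x" for x
    proof -
      have "(\<lambda>K. trig_sum c K x - t x) \<longlonglongrightarrow> g x"
        unfolding g_def f_def by (intro tendsto_diff tendsto_const series_in_C2pi_limit c)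
      moreover have "\<forall>\<^sub>F K in sequentially. trig_sum c K x - t x = trig_sum e K x"
        using eventually_ge_at_top[of n] by eventually_elim (simp add: trig_e)
      ultimately show ?thesis by (rule Lim_transform_eventually)
    qed
    have contg: "continuous_on UNIV g" using g by (simp add: C2pi_def)
    have fejer: "norm (fejer_mean e m N) \<le> B" if "N \<ge> 1" for m N
      using norm_fejer_mean_le[OF trig_series_coeffs[OF lim contg], of N B 0 m] that
      by (simp add: gB mult_right_mono fejer_kernel_nonneg)
    have outside: "e k = c k" if "\<bar>k\<bar> > int n" for k using that by (simp add: e_def)
    have fejer_c: "norm (fejer_mean c m N) \<le> B" if "N \<ge> 1" "\<bar>m\<bar> \<ge> int (n + N)" for m N
    proof -
      have "fejer_mean c m N = fejer_mean e m N"
        unfolding fejer_mean_def using that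
        by (intro arg_cong2[of _ _ _ _ "(/)"] refl sum.cong outside[symmetric]) auto
      then show ?thesis using fejer that by simp
    qed
    have fejer_b: "norm (fejer_mean (\<lambda>k. c k + c (- k)) m N) \<le> 2 * B" if "N \<ge> 1" "\<bar>m\<bar> \<ge> int (n + N)" for m N
      unfolding fejer_mean_even_part
      using fejer_c[of N m] fejer_c[of N "- m"] that by (intro norm_triangle_le) simp
    have both: "real k * (norm (c (int (n' + k))) + norm (c (- int (n' + k)))) \<le> C3 * B"
      if "n \<le> n'" "1 \<le> k" "k \<le> n'" for n' k
    proof -
      have "real k * norm (?a (n' + k)) \<le> C1 * B" using that by (intro C1'[rule_format] fejer_c) auto
      moreover have "real k * norm (?b (n' + k)) \<le> C2 * (2 * B)" using that by (intro C2'[rule_format] fejer_b) auto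
      moreover have "norm (c (- int (n' + k))) \<le> norm (?b (n' + k)) + norm (?a (n' + k))"
        using norm_triangle_ineq4[of "?b (n' + k)" "?a (n' + k)"] by simp
      then have "real k * norm (c (- int (n' + k))) \<le> real k * (norm (?b (n' + k)) + norm (?a (n' + k)))"
        by (rule mult_left_mono) simp
      ultimately show ?thesis by (simp add: C3_def algebra_simps)
    qed
    have C_ge: "C3 * B \<le> C * B" "3 * (C3 * B) \<le> C * B" "4 * B / \<kappa> \<le> C * B"
      using B0 pos \<kappa> by (simp_all add: C_def algebra_simps)
    show ?thesis
    proof (intro conjI ballI allI impI)
      fix k assume "k \<in> {1..n}"
      then show "real k * (norm (c (int (n + k))) + norm (c (- int (n + k)))) \<le> C * B"
        using both[of n k] C_ge by simp
    next
      fix k assume k: "2 * n + 1 \<le> k"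
      define k' where "k' = k div 2"
      have k': "n \<le> k - k'" "1 \<le> k'" "k' \<le> k - k'" "k \<le> 3 * k'" "k - k' + k' = k"
        using k n by (auto simp: k'_def)
      have "real k * norm (c (int k) - c (- int k)) \<le> (3 * real k') * (norm (c (int k)) + norm (c (- int k)))"
        using k' by (intro mult_mono norm_triangle_ineq4) auto
      also have "\<dots> \<le> 3 * (C3 * B)"
        using both[of "k - k'" k'] k' by simp
      finally show "real k * norm (c (int k) - c (- int k)) \<le> C * B" using C_ge by simp
    next
      fix s
      \<comment> \<open>The complement of the de la Vallee-Poussin weight: 0 up to \<open>n\<close>,
        linear up to \<open>2 * n\<close>, then 1. It hides the frequencies of \<open>t\<close> and
        is nonnegative, so the cone condition applies to the weighted sums.\<close>
      define w where "w k = 1 - 2 * max 0 (1 - \<bar>of_int k\<bar> / real (2 * n)) + max 0 (1 - \<bar>of_int k\<bar> / real n)"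
        for k :: int
      have w_inside: "w k = 0" if "\<bar>k\<bar> \<le> int n" for k
      proof -
        have "\<bar>of_int k\<bar> \<le> real n" using that by linarith
        then show ?thesis using n by (simp add: w_def max_def field_simps)
      qed
      have w_nonneg: "w k \<ge> 0" if "\<bar>k\<bar> \<ge> int n" for k
      proof -
        have "real n \<le> \<bar>of_int k\<bar>" using that by linarith
        then show ?thesis using n by (simp add: w_def max_def field_simps)
      qed
      have w_outside: "w k = 1" if "\<bar>k\<bar> \<ge> int (2 * n)" for k
      proof -
        have "real (2 * n) \<le> \<bar>of_int k\<bar>" using that by linarith
        then show ?thesis using n by (simp add: w_def max_def field_simps)
      qed
      have w_even: "w (- k) = w k" for k by (simp add: w_def)
      \<comment> \<open>Kept at finite \<open>K\<close>, since the partial sums of \<open>e\<close>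
        are controlled only in the limit, by \<open>g 0\<close>; the Fejer means of orders
        \<open>2 * n\<close> and \<open>n\<close> contribute \<open>2 * B\<close> and
        \<open>B\<close>.\<close>
      have bound: "\<kappa> * (\<Sum>k=2 * n + 1..<s. norm (?b k)) \<le> norm (trig_sum e K 0) + 3 * B"
        if K: "K \<ge> s + 2 * n" for K
      proof -
        have "\<kappa> * (\<Sum>k=2 * n + 1..<s. norm (?b k)) \<le> (\<Sum>k=2 * n + 1..<s. w (int k) * Re (?b k))"
          unfolding sum_distrib_left
        proof (rule sum_mono)
          fix k assume k: "k \<in> {2 * n + 1..<s}"
          have "w (int k) = 1" by (rule w_outside) (use k in auto)
          then show "\<kappa> * norm (?b k) \<le> w (int k) * Re (?b k)" using \<kappa>(2)[of k] k by simp
        qed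
        also have "\<dots> \<le> (\<Sum>k=1..K. w (int k) * Re (?b k))"
        proof (rule sum_mono2)
          fix k assume "k \<in> {1..K} - {2 * n + 1..<s}"
          then have "0 \<le> Re (?b k)" using \<kappa>(2)[of k] \<kappa>(1)
            by (intro order_trans[OF _ \<kappa>(2)[of k]]) auto
          moreover have "0 \<le> w (int k)" using w_inside[of "int k"] w_nonneg[of "int k"] by (cases "k \<le> n") auto
          ultimately show "0 \<le> w (int k) * Re (?b k)" by simp
        qed (use K in auto)
        also have "\<dots> = Re (\<Sum>k=1..K. of_real (w (int k)) * (e (int k) + e (- int k)))"
          unfolding Re_sum
        proof (rule sum.cong[OF refl])
          fix k assume "k \<in> {1..K}"
          show "w (int k) * Re (?b k) = Re (of_real (w (int k)) * (e (int k) + e (- int k)))"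
            using w_inside[of "int k"] outside[of "int k"] outside[of "- int k"] by (cases "k \<le> n") auto
        qed
        also have "(\<Sum>k=1..K. of_real (w (int k)) * (e (int k) + e (- int k))) =
            (\<Sum>k = - int K..int K. of_real (w k) * e k)"
          using w_inside[of 0] by (simp add: sum_symmetric_int w_even distrib_left)
        also have "\<dots> = trig_sum e K 0 - 2 * fejer_mean e 0 (2 * n) + fejer_mean e 0 n"
        proof -
          have "n \<ge> 1" "2 * n \<ge> 1" "n \<le> K" "2 * n \<le> K" using n K by auto
          then show ?thesis
            by (simp only: fejer_mean_eq_sum[where K = K] trig_sum_cis w_def)
               (simp add: sum_distrib_left sum_subtractf sum.distrib algebra_simps)
        qed
        also have "Re \<dots> \<le> norm \<dots>" by (rule complex_Re_le_cmod)
        also have "\<dots> \<le> norm (trig_sum e K 0) + 2 * norm (fejer_mean e 0 (2 * n)) + norm (fejer_mean e 0 n)"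
          using norm_triangle_ineq[of "trig_sum e K 0 - 2 * fejer_mean e 0 (2 * n)" "fejer_mean e 0 n"]
            norm_triangle_ineq4[of "trig_sum e K 0" "2 * fejer_mean e 0 (2 * n)"]
          by (simp add: norm_mult)
        also have "\<dots> \<le> norm (trig_sum e K 0) + 3 * B"
          using fejer[of "2 * n" 0] fejer[of n 0] n by simp
        finally show ?thesis .
      qed
      have "\<kappa> * (\<Sum>k=2 * n + 1..<s. norm (?b k)) \<le> norm (g 0) + 3 * B"
        by (rule LIMSEQ_le_const[OF tendsto_add[OF tendsto_norm[OF lim[of 0]] tendsto_const]])
          (use bound in blast)
      also have "\<dots> \<le> 4 * B" using gB[of 0] by simp
      finally have "(\<Sum>k=2 * n + 1..<s. norm (?b k)) \<le> 4 * B / \<kappa>"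
        using \<kappa>(1) by (simp add: pos_le_divide_eq mult.commute)
      then show "(\<Sum>k=2 * n + 1..<s. norm (?b k)) \<le> C * B" using C_ge by simp
    qed
  qed
  have inf: "y \<le> C * best_approx n f"
    if "\<And>t. t \<in> trig_polys n \<Longrightarrow> y \<le> C * sup_norm (\<lambda>x. f x - t x)" for y n
  proof -
    have "y / C \<le> best_approx n f"
      unfolding best_approx_def
    proof (rule cINF_greatest)
      show "trig_polys n \<noteq> {}" by (simp add: trig_polys_def)
      fix t assume "t \<in> trig_polys n"
      from that[OF this] show "y / C \<le> sup_norm (\<lambda>x. f x - t x)"
        using pos by (simp add: pos_divide_le_eq mult.commute)
    qed
    then show ?thesis using pos by (simp add: pos_divide_le_eq mult.commute)
  qed
  show ?thesis
    unfolding f_def[symmetric]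
  proof (intro exI[of _ C] conjI allI impI ballI pos)
    fix n k :: nat assume "1 \<le> n" "k \<in> {1..n}"
    then show "real k * (norm (c (int (n + k))) + norm (c (- int (n + k)))) \<le> C * best_approx n f"
      using main by (intro inf) blast
  next
    fix n k :: nat assume "1 \<le> n" "2 * n + 1 \<le> k"
    then show "real k * norm (c (int k) - c (- int k)) \<le> C * best_approx n f"
      using main by (intro inf) blast
  next
    fix n t :: nat assume "1 \<le> n"
    then show "(\<Sum>k=2 * n + 1..<t. norm (c (int k) + c (- int k))) \<le> C * best_approx n f"
      using main by (intro inf) blast
  qed
qed


section \<open>The equivalence and the two-sided estimate\<close>

theorem theorem1:
  fixes fhat :: "int \<Rightarrow> complex" and f :: "real \<Rightarrow> complex"
  assumes "GBV (\<lambda>n. fhat (int n))"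
    and "GBV (\<lambda>n. fhat (int n) + fhat (- int n))"
    and "f = trig_series fhat"
  shows "(series_in_C2pi fhat \<longleftrightarrow>
            summable (\<lambda>n. norm (fhat (int (n + 1)) + fhat (- int (n + 1)))) \<and>
            (\<lambda>n. of_nat n * fhat (int n)) \<longlonglongrightarrow> 0) \<and>
         (series_in_C2pi fhat \<longrightarrow>
            same_order (\<lambda>n. best_approx n f)
              (\<lambda>n. Max ((\<lambda>k. real k * (norm (fhat (int (n + k))) + norm (fhat (- int (n + k))))) ` {1..n})
                 + (SUP k\<in>{2 * n + 1..}. real k * norm (fhat (int k) - fhat (- int k)))
                 + (\<Sum>k. norm (fhat (int (2 * n + 1 + k)) + fhat (- int (2 * n + 1 + k))))))"
proof -
  note a = assms(1) and b = assms(2)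
  let ?b = "\<lambda>n. fhat (int n) + fhat (- int n)"
  have shift: "summable (\<lambda>n. norm (?b (n + 1))) \<longleftrightarrow> summable (\<lambda>n. norm (?b n))"
    using summable_iff_shift[of "\<lambda>n. norm (?b n)" 1] .
  have iff: "series_in_C2pi fhat \<longleftrightarrow> summable (\<lambda>n. norm (?b n)) \<and> (\<lambda>n. of_nat n * fhat (int n)) \<longlonglongrightarrow> 0"
    using series_in_C2pi_imp_summable[OF b] series_in_C2pi_imp_index_mult_tendsto_0[OF a]
      series_in_C2pi_sufficient[OF a] by (auto simp: series_in_C2pi_def)
  moreover have "same_order (\<lambda>n. best_approx n f)
      (\<lambda>n. Max ((\<lambda>k. real k * (norm (fhat (int (n + k))) + norm (fhat (- int (n + k))))) ` {1..n})
         + (SUP k\<in>{2 * n + 1..}. real k * norm (fhat (int k) - fhat (- int k)))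
         + (\<Sum>k. norm (?b (2 * n + 1 + k))))"
    if C: "series_in_C2pi fhat"
  proof -
    define J where "J n = Max ((\<lambda>k. real k * (norm (fhat (int (n + k))) + norm (fhat (- int (n + k))))) ` {1..n})" for n
    define D where "D n = (SUP k\<in>{2 * n + 1..}. real k * norm (fhat (int k) - fhat (- int k)))" for n
    define R where "R n = (\<Sum>k. norm (?b (2 * n + 1 + k)))" for n
    have summ: "summable (\<lambda>n. norm (?b n))" and lim: "(\<lambda>n. of_nat n * fhat (int n)) \<longlonglongrightarrow> 0"
      using C iff by blast+
    have fC: "f \<in> C2pi" using C by (simp add: assms(3) series_in_C2pi_def)
    have summ': "summable (\<lambda>k. norm (?b (m + k)))" for m
      using summable_iff_shift[of "\<lambda>n. norm (?b n)" m] summ by (simp add: add.commute)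
    have partial: "(\<Sum>k=m..<t. norm (?b k)) \<le> (\<Sum>k. norm (?b (m + k)))" for m t
    proof -
      have "(\<Sum>k=m..<t. norm (?b k)) = (\<Sum>k<t - m. norm (?b (m + k)))"
        using sum.atLeastLessThan_shift_0[of "\<lambda>k. norm (?b k)" m t]
        by (simp add: atLeast0LessThan o_def)
      also have "\<dots> \<le> (\<Sum>k. norm (?b (m + k)))" by (rule sum_le_suminf[OF summ']) auto
      finally show ?thesis .
    qed
    \<comment> \<open>A real supremum is an upper bound only for a set that is bounded above. Here
      \<open>k\<close> times the coefficient is bounded by its limit, and \<open>k\<close> times the
      symmetric sum by summability with block variation.\<close>
    have bdd: "bdd_above ((\<lambda>k. real k * norm (fhat (int k) - fhat (- int k))) ` {2 * n + 1..})" for n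
    proof -
      obtain N M where V: "block_variation ?b N M" using GBV_imp_block_variation[OF b] by blast
      obtain B where B: "\<And>k. norm (of_nat k * fhat (int k)) \<le> B"
        using convergent_imp_Bseq[OF convergentI[OF lim]] by (meson BseqE)
      show ?thesis
      proof (rule bdd_aboveI2)
        fix k assume k: "k \<in> {2 * n + 1..}"
        have "norm (fhat (int k) - fhat (- int k)) = norm (2 * fhat (int k) - ?b k)" by simp
        also have "\<dots> \<le> 2 * norm (fhat (int k)) + norm (?b k)"
          by (rule order_trans[OF norm_triangle_ineq4]) (simp add: norm_mult)
        finally have "real k * norm (fhat (int k) - fhat (- int k)) \<le>
            real k * (2 * norm (fhat (int k)) + norm (?b k))"
          by (intro mult_left_mono) auto
        also have "\<dots> = 2 * norm (of_nat k * fhat (int k)) + real k * norm (?b k)"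
          by (simp add: norm_mult distrib_left)
        also have "\<dots> \<le> 2 * B + max (norm (?b 1)) (2 * (M + 1) * N * (\<Sum>k. norm (?b (1 + k))))"
        proof (intro add_mono mult_left_mono B)
          show "real k * norm (?b k) \<le> max (norm (?b 1)) (2 * (M + 1) * N * (\<Sum>k. norm (?b (1 + k))))"
          \<comment> \<open>The index estimate with \<open>m = 1\<close> starts at
            \<open>k = 2\<close>, while \<open>n = 0\<close> is allowed here.\<close>
          proof (cases "k = 1")
            case False
            then have "real k * norm (?b k) \<le> 2 * (M + 1) * N * (\<Sum>k. norm (?b (1 + k)))"
              using k by (intro block_variation_index_mult_le[OF V _ _ partial]) auto
            then show ?thesis by simp
          qed simp
        qed simp
        finally show "real k * norm (fhat (int k) - fhat (- int k)) \<le>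
            2 * B + max (norm (?b 1)) (2 * (M + 1) * N * (\<Sum>k. norm (?b (1 + k))))" .
      qed
    qed
    have J: "real k * (norm (fhat (int (n + k))) + norm (fhat (- int (n + k)))) \<le> J n" if "k \<in> {1..n}" for n k
      unfolding J_def using that by (intro Max_ge) auto
    have D: "real k * norm (fhat (int k) - fhat (- int k)) \<le> D n" if "k \<ge> 2 * n + 1" for n k
      unfolding D_def using that by (intro cSUP_upper bdd) auto
    obtain C1 where C1: "C1 > 0" and upper: "\<forall>n\<ge>1. \<forall>J D R K x.
      (\<forall>k\<in>{1..n}. real k * (norm (fhat (int (n + k))) + norm (fhat (- int (n + k)))) \<le> J) \<and>
      (\<forall>k\<ge>2 * n + 1. real k * norm (fhat (int k) - fhat (- int k)) \<le> D) \<and>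
      (\<forall>t. (\<Sum>k=2 * n + 1..<t. norm (?b k)) \<le> R) \<and> K \<ge> 4 * n + 1 \<longrightarrow>
      norm (trig_sum fhat K x - near_best fhat n x) \<le> C1 * (J + D + R)"
      using norm_trig_sum_minus_near_best_le[OF a b] by blast
    have le: "best_approx n f \<le> C1 * (J n + D n + R n)" if n: "n \<ge> 1" for n
    proof (rule best_approx_le[OF fC near_best_in_trig_polys[of fhat n]])
      fix x
      show "norm (f x - near_best fhat n x) \<le> C1 * (J n + D n + R n)"
      proof (rule LIMSEQ_le_const2)
        show "(\<lambda>K. norm (trig_sum fhat K x - near_best fhat n x)) \<longlonglongrightarrow> norm (f x - near_best fhat n x)"
          unfolding assms(3) by (intro tendsto_norm tendsto_diff tendsto_const series_in_C2pi_limit C)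
        show "\<exists>N. \<forall>K\<ge>N. norm (trig_sum fhat K x - near_best fhat n x) \<le> C1 * (J n + D n + R n)"
        proof (intro exI[of _ "4 * n + 1"] allI impI)
          fix K assume "4 * n + 1 \<le> K"
          then show "norm (trig_sum fhat K x - near_best fhat n x) \<le> C1 * (J n + D n + R n)"
            using n J[of _ n] D[of n] partial[of "2 * n + 1"] by (intro upper[rule_format]) (auto simp: R_def)
        qed
      qed
    qed
    obtain C2 where C2: "C2 > 0" and lower: "\<forall>n\<ge>1.
      (\<forall>k\<in>{1..n}. real k * (norm (fhat (int (n + k))) + norm (fhat (- int (n + k)))) \<le> C2 * best_approx n f) \<and>
      (\<forall>k\<ge>2 * n + 1. real k * norm (fhat (int k) - fhat (- int k)) \<le> C2 * best_approx n f) \<and>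
      (\<forall>t. (\<Sum>k=2 * n + 1..<t. norm (?b k)) \<le> C2 * best_approx n f)"
      using best_approx_ge[OF a b C] unfolding assms(3) by blast
    have ge: "J n + D n + R n \<le> 3 * C2 * best_approx n f" if n: "n \<ge> 1" for n
    proof -
      have "J n \<le> C2 * best_approx n f"
        unfolding J_def using lower n by (intro Max.boundedI) auto
      moreover have "D n \<le> C2 * best_approx n f"
        unfolding D_def using lower n by (intro cSUP_least) auto
      moreover have "R n \<le> C2 * best_approx n f"
        unfolding R_def
      proof (rule suminf_le_const[OF summ'])
        fix t
        have "(\<Sum>k<t. norm (?b (2 * n + 1 + k))) = (\<Sum>k=2 * n + 1..<2 * n + 1 + t. norm (?b k))"
          using sum.atLeastLessThan_shift_0[of "\<lambda>k. norm (?b k)" "2 * n + 1" "2 * n + 1 + t"]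
          by (simp add: atLeast0LessThan o_def)
        also have "\<dots> \<le> C2 * best_approx n f" using lower n by blast
        finally show "(\<Sum>k<t. norm (?b (2 * n + 1 + k))) \<le> C2 * best_approx n f" .
      qed
      ultimately show ?thesis by simp
    qed
    define K where "K = max C1 (3 * C2)"
    have K: "K > 0" "C1 \<le> K" "3 * C2 \<le> K" using C1 by (auto simp: K_def)
    have "inverse K * (J n + D n + R n) \<le> best_approx n f \<and> best_approx n f \<le> K * (J n + D n + R n)"
      if n: "n \<ge> 1" for n
    proof
      have J0: "0 \<le> J n" by (rule order_trans[OF _ J[of 1]]) (use n in auto)
      have D0: "0 \<le> D n" by (rule order_trans[OF _ D[of n "2 * n + 1"]]) auto
      have R0: "0 \<le> R n" unfolding R_def by (intro suminf_nonneg summ') auto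
      \<comment> \<open>Nonnegativity of the best approximation is read off the lower estimate; it
        permits enlarging \<open>3 * C2\<close> to the common constant \<open>K\<close>.\<close>
      have "0 \<le> 3 * C2 * best_approx n f" using ge[OF n] J0 D0 R0 by linarith
      then have A0: "0 \<le> best_approx n f" using C2 by (simp add: zero_le_mult_iff)
      have "J n + D n + R n \<le> K * best_approx n f"
        by (rule order_trans[OF ge[OF n] mult_right_mono[OF K(3) A0]])
      then show "inverse K * (J n + D n + R n) \<le> best_approx n f"
        using K(1) by (simp add: field_simps)
      show "best_approx n f \<le> K * (J n + D n + R n)"
        by (rule order_trans[OF le[OF n] mult_right_mono[OF K(2)]]) (use J0 D0 R0 in simp)
    qed
    then show ?thesis
      unfolding same_order_def J_def[symmetric] D_def[symmetric] R_def[symmetric] using K(1) by blast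
  qed
  ultimately show ?thesis unfolding shift by blast
qed

end
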